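(* Consider all tuples of positive integers $(a_1,\ldots,a_K,b_1,\ldots,b_{K+1})$ (with $K\ge 1$ arbitrary) such that $\sum_i a_i=\sum_j b_j$, $a_i\neq b_j$ for all $i,j$, $\gcd(a_1,\ldots,a_K,b_1,\ldots,b_{K+1})=1$, and $$\frac{(a_1n)!\cdots(a_Kn)!}{(b_1n)!\cdots(b_{K+1}n)!}\in\mathbb{N}\quad\text{for all positive integers } n.$$ Then all but finitely many such tuples are, up to permuting the $a_i$ among themselves and the $b_j$ among themselves, of one of the forms $$(a+b;\ a,b),\qquad (2a,2b;\ a,b,a+b),\qquad (2a,b;\ a,2b,a-b)\ \ (a>b),$$ (numerator entries before the semicolon, denominator entries after), for coprime positive integers $a,b$; i.e. corresponding to the factorial ratios $\frac{((a+b)n)!}{(an)!(bn)!}$, $\frac{(2an)!(2bn)!}{(an)!(bn)!((a+b)n)!}$, $\frac{(2an)!(bn)!}{(an)!(2bn)!((a-b)n)!}$. *)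

theory Defs
  imports Complex_Main "HOL-Library.Multiset"
begin

definition factorial_ratio :: "nat list \<Rightarrow> nat list \<Rightarrow> nat \<Rightarrow> rat" where
  "factorial_ratio as bs n =
     (\<Prod>a\<leftarrow>as. fact (a * n)) / (\<Prod>b\<leftarrow>bs. fact (b * n))"

text \<open>A tuple \<open>(a\<^sub>1, \<dots>, a\<^sub>K, b\<^sub>1, \<dots>, b\<^sub>K\<^sub>+\<^sub>1)\<close> is encoded as the pair of lists of its
  \<open>a\<close>-entries and \<open>b\<close>-entries, so that \<open>K\<close> is the length of the first list.\<close>

definition admissible :: "nat list \<Rightarrow> nat list \<Rightarrow> bool" where
  "admissible as bs \<longleftrightarrow>
     length as \<ge> 1 \<and> length bs = length as + 1 \<and>
     (\<forall>a\<in>set as. a > 0) \<and> (\<forall>b\<in>set bs. b > 0) \<and>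
     sum_list as = sum_list bs \<and>
     (\<forall>a\<in>set as. \<forall>b\<in>set bs. a \<noteq> b) \<and>
     Gcd (set as \<union> set bs) = 1 \<and>
     (\<forall>n>0. factorial_ratio as bs n \<in> \<nat>)"

text \<open>Equality of multisets is equality up to permuting the \<open>a\<close>-entries among themselves and
  the \<open>b\<close>-entries among themselves. The subtraction \<open>a - b\<close> is only used for \<open>a > b\<close>.\<close>

definition in_family :: "nat list \<Rightarrow> nat list \<Rightarrow> bool" where
  "in_family as bs \<longleftrightarrow>
     (\<exists>a b :: nat. a > 0 \<and> b > 0 \<and> coprime a b \<and>
        (mset as = {#a + b#} \<and> mset bs = {#a, b#} \<or>
         mset as = {#2 * a, 2 * b#} \<and> mset bs = {#a, b, a + b#} \<or>
         a > b \<and> mset as = {#2 * a, b#} \<and> mset bs = {#a, 2 * b, a - b#}))"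

end

(* Landau's criterion turns the hypothesis into the statement that f(x) = sum_i saw(a_i x) - sum_j saw(b_j x),
   saw(y) = 1/2 - {y}, takes only the values 1/2 and -1/2 at generic points. The mean of saw(a x) saw(b x) is
   1 / (12 h(a,b)) with h = lcm/gcd, so the quadratic form Q = sum m_a m_b / h(a,b) in the signed
   multiplicities m equals 3. All means are taken over the midpoints (2j+1)/(2M) with M a common multiple of
   the entries; there the formula is exact up to a multiple of the square of sigma = sum c m_c, and every
   midpoint is generic, so no integrals are needed.

   Length. Restricting the kernel 1/h to pairs for which no prime p <= P divides h costs a factor
   (p+1)/(p-1) for each p. For P a multiple of the number n of entries the restricted form is at
   least n/2, while the product of the factors is O(n^(2/3)). Hence Q = 3 bounds n.

   Rigidity. For fixed n, an infinite set of tuples has an infinite subset on which every ratio c_i/c_j is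
   constant or injective. Constancy of the ratio groups the indices into clusters, the cross terms between
   clusters tend to 0, and so the forms of the clusters add up to 3. A cluster with sigma different from 0 has
   form at least 1, because f is then congruent modulo 1 to a single sawtooth or to saw(2dx) - saw(dx), which
   has the least absolute value in its class; equality forces the cluster to be {d} or {2d; d}. A cluster with
   sigma = 0 and an odd number of entries has form at least 3. As the sigmas add up to 0, the number of
   clusters with sigma different from 0 is neither 1 nor (as ratios between clusters vary) 2. If it is 0, there
   is just one cluster and the tuple is determined by its gcd. So there are three clusters {d} or {2d; d},
   which are the three families. *)

theory Submission
  imports Defs "HOL-Computational_Algebra.Primes"
begin

section \<open>Discrete means of products of sawtooth functions\<close>

definition saw :: "real \<Rightarrow> real" where
  "saw y = 1/2 - frac y"

lemma saw_add_int: "saw (y + of_int k) = saw y"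
  by (simp add: saw_def frac_def)

lemma saw_add_nat: "saw (y + of_nat k) = saw y"
  using saw_add_int[of y "int k"] by simp

section \<open>Periodic sums and the distribution relation of the sawtooth\<close>

lemma sum_periodic_shift:
  fixes h :: "nat \<Rightarrow> 'a::comm_monoid_add"
  assumes "\<And>j. h (j + q) = h j"
  shows "(\<Sum>j<q. h (j + t)) = (\<Sum>j<q. h j)"
proof (induction t)
  case (Suc t)
  have "(\<Sum>j<q. h (j + Suc t)) = (\<Sum>j<q. h (j + t))"
  proof (cases q)
    case (Suc r)
    have "(\<Sum>j<q. h (j + Suc t)) = (\<Sum>j<r. h (Suc j + t)) + h (t + q)"
      by (simp add: Suc add.commute)
    also have "\<dots> = (\<Sum>j<q. h (j + t))"
      unfolding Suc sum.lessThan_Suc_shift using assms[of t] Suc by (simp add: add.commute)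
    finally show ?thesis .
  qed simp
  with Suc show ?case by simp
qed simp

text \<open>Multiplication by a unit \<open>r\<close> permutes the residues modulo
  \<open>q\<close>.\<close>

lemma sum_periodic_coprime:
  fixes h :: "nat \<Rightarrow> 'a::comm_monoid_add"
  assumes per: "\<And>j. h (j + q) = h j" and "coprime r q" "q > 0"
  shows "(\<Sum>i<q. h (i * r)) = (\<Sum>i<q. h i)"
proof -
  have per': "h (j + k * q) = h j" for j k
  proof (induction k)
    case (Suc k)
    have "h (j + Suc k * q) = h ((j + k * q) + q)"
      by (simp add: algebra_simps)
    then show ?case using Suc per by simp
  qed simp
  have hm: "h (j mod q) = h j" for j
    using per'[of "j mod q" "j div q"] by simp
  have inj: "inj_on (\<lambda>i. (i * r) mod q) {..<q}"
  proof (rule linorder_inj_onI)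
    fix x y :: nat
    assume "x < y" "x \<in> {..<q}" "y \<in> {..<q}"
    show "x * r mod q \<noteq> y * r mod q"
    proof
      assume "x * r mod q = y * r mod q"
      then have "q dvd y * r - x * r"
        using \<open>x < y\<close> by (metis mod_eq_dvd_iff_nat mult_le_mono1 less_imp_le_nat)
      then have "q dvd (y - x) * r" by (simp add: diff_mult_distrib)
      then have "q dvd y - x"
        using assms(2) by (simp add: coprime_commute coprime_dvd_mult_left_iff)
      then show False using \<open>x < y\<close> \<open>y \<in> {..<q}\<close>
        by (auto dest: dvd_imp_le)
    qed
  qed auto
  have "(\<lambda>i. (i * r) mod q) ` {..<q} = {..<q}"
    using inj assms(3) by (intro card_subset_eq) (auto simp: card_image)
  then have "(\<Sum>i<q. h i) = (\<Sum>i<q. h ((i * r) mod q))"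
    using sum.reindex[OF inj, of h] by simp
  then show ?thesis by (simp add: hm)
qed

text \<open>This is the distribution relation of the first periodic Bernoulli function, of which
  \<open>saw\<close> is the negative. Up to an integer and a rotation of the summands,
  \<open>y\<close> may be replaced by some \<open>y0\<close> in [0, 1/q); then no term
  \<open>y0 + i/q\<close> with \<open>i < q\<close> reaches 1, and the sum is that of an arithmetic
  progression.\<close>

lemma saw_distribution_aux:
  assumes "q > 0"
  shows "(\<Sum>i<q. saw (y + real i / real q)) = saw (real q * y)"
proof -
  define k where "k = \<lfloor>real q * y\<rfloor>"
  define l where "l = nat (k mod int q)"
  define y0 where "y0 = frac (real q * y) / real q"
  have y0: "0 \<le> y0" "y0 < 1 / q"
    using assms frac_lt_1[of "real q * y"] by (auto simp: y0_def divide_simps)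
  have "real q * y = real_of_int k + real q * y0"
    using assms by (simp add: y0_def k_def frac_def)
  moreover have "k = int q * (k div int q) + int l"
    using assms by (simp add: l_def)
  ultimately have "real q * y = real q * of_int (k div int q) + real l + real q * y0"
    by (metis of_int_add of_int_mult of_int_of_nat_eq)
  then have y: "y = y0 + real l / real q + of_int (k div int q)"
    using assms by (simp add: field_simps)
  have "(\<Sum>i<q. saw (y + real i / real q)) = (\<Sum>i<q. saw (y0 + real (i + l) / real q))"
  proof (rule sum.cong)
    fix i
    have "y + real i / real q = (y0 + real (i + l) / real q) + of_int (k div int q)"
      by (simp add: y add_divide_distrib)
    then show "saw (y + real i / real q) = saw (y0 + real (i + l) / real q)"
      by (simp only: saw_add_int)
  qed simp
  also have "\<dots> = (\<Sum>i<q. saw (y0 + real i / real q))"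
  proof (rule sum_periodic_shift)
    fix j
    have "y0 + real (j + q) / real q = (y0 + real j / real q) + of_int 1"
      using assms by (simp add: add_divide_distrib)
    then show "saw (y0 + real (j + q) / real q) = saw (y0 + real j / real q)"
      by (simp only: saw_add_int)
  qed
  also have "\<dots> = (\<Sum>i<q. 1/2 - y0 - real i / real q)"
  proof (rule sum.cong)
    fix i assume "i \<in> {..<q}"
    then have "real i + 1 \<le> real q" by simp
    then have "y0 + real i / real q < 1"
      using y0 assms by (simp add: field_simps)
    then have "frac (y0 + real i / real q) = y0 + real i / real q"
      using y0 by (simp add: frac_eq)
    then show "saw (y0 + real i / real q) = 1/2 - y0 - real i / real q"
      by (simp add: saw_def)
  qed simp
  also have "\<dots> = 1/2 - real q * y0"
  proof -
    have "2 * (\<Sum>i<q. real i) = real q * (real q - 1)"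
      by (induction q) (auto simp: algebra_simps)
    then have "(\<Sum>i<q. real i / real q) = (real q - 1) / 2"
      using assms by (simp add: sum_divide_distrib[symmetric] field_simps)
    moreover have "(\<Sum>i<q. (1/2 - y0) - real i / real q) =
        real q * (1/2 - y0) - (\<Sum>i<q. real i / real q)"
      by (subst sum_subtractf) simp
    moreover have "real q * (1/2 - y0) = real q / 2 - real q * y0" by (simp add: right_diff_distrib)
    ultimately show ?thesis by argo
  qed
  also have "\<dots> = saw (real q * y)"
    using assms by (simp add: saw_def y0_def)
  finally show ?thesis .
qed

lemma saw_distribution:
  assumes "q > 0" "coprime r q"
  shows "(\<Sum>i<q. saw (y + real (i * r) / real q)) = saw (real q * y)"
proof -
  have "saw (y + real (j + q) / real q) = saw (y + real j / real q)" for j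
    using saw_add_int[of "y + real j / real q" 1] assms
    by (simp add: add_divide_distrib add.assoc)
  from sum_periodic_coprime[of "\<lambda>j. saw (y + real j / real q)", OF this assms(2,1)]
  show ?thesis using saw_distribution_aux[OF assms(1)] by simp
qed

section \<open>Heights of ratios and exact means over midpoints\<close>

text \<open>For positive arguments this is lcm/gcd, the numerator times the denominator of the
  reduced fraction a/b. It depends on the ratio only.\<close>

definition ht :: "nat \<Rightarrow> nat \<Rightarrow> nat" where
  "ht a b = (a div gcd a b) * (b div gcd a b)"

text \<open>For a divisor \<open>c\<close> of \<open>M\<close>, \<open>c\<close> times a midpoint is
  an odd integer over an even one, so that no sawtooth is sampled at a jump.\<close>

definition midpoint :: "nat \<Rightarrow> nat \<Rightarrow> real" where
  "midpoint M j = (2 * real j + 1) / (2 * real M)"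

text \<open>All these midpoints lie in (0, 1), where the sawtooth is affine; what remains is the sum
  of the squares of the progression \<open>M - 2 * j - 1\<close>. The deviation from
  \<open>M / 12\<close> is the source of the correction terms below.\<close>

lemma sum_saw_square:
  assumes "M > 0"
  shows "(\<Sum>j<M. (saw (midpoint M j))\<^sup>2) = real M / 12 - 1 / (12 * real M)"
proof -
  have eq: "saw (midpoint M j) = 1/2 - midpoint M j" if "j < M" for j
  proof -
    have "frac (midpoint M j) = midpoint M j"
      using that by (simp add: midpoint_def frac_eq field_simps)
    then show ?thesis by (simp add: saw_def)
  qed
  have "(\<Sum>j<n. (real N - 2 * real j - 1)\<^sup>2) =
      real n * (real N)\<^sup>2 - 2 * real N * (real n)\<^sup>2 + (4 * real n ^ 3 - real n) / 3" for n N :: nat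
    by (induction n) (auto simp: field_simps power2_eq_square power3_eq_cube)
  from this[of M M] have *: "(\<Sum>j<M. (real M - 2 * real j - 1)\<^sup>2) = (real M ^ 3 - real M) / 3"
    by (simp add: field_simps power2_eq_square power3_eq_cube)
  have "(\<Sum>j<M. (saw (midpoint M j))\<^sup>2) = (\<Sum>j<M. (real M - 2 * real j - 1)\<^sup>2 / (4 * (real M)\<^sup>2))"
  proof (rule sum.cong)
    fix j assume "j \<in> {..<M}"
    then have "saw (midpoint M j) = (real M - 2 * real j - 1) / (2 * real M)"
      using eq[of j] assms by (simp add: midpoint_def field_simps)
    then show "(saw (midpoint M j))\<^sup>2 = (real M - 2 * real j - 1)\<^sup>2 / (4 * (real M)\<^sup>2)"
      by (simp add: power_divide power_mult_distrib)
  qed simp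
  also have "\<dots> = real M / 12 - 1 / (12 * real M)"
    using assms * by (simp add: sum_divide_distrib[symmetric] field_simps power2_eq_square power3_eq_cube)
  finally show ?thesis .
qed

text \<open>As \<open>h\<close> is invariant under shifts by \<open>M div a\<close>, the sum may be
  averaged over \<open>p\<close> such shifts. Each of them moves the midpoint by 1/a, hence
  \<open>b\<close> times it by b/a = r/p, and the distribution relation merges the \<open>p\<close>
  shifted sawtooths into one.\<close>

lemma sum_saw_average:
  assumes M: "M > 0" "a dvd M" "b dvd M" "a > 0" "b > 0" and p: "p = a div gcd a b"
    and per: "\<And>j. h (j + M div a) = h j"
  shows "(\<Sum>j<M. h j * saw (real b * midpoint M j)) =
    (\<Sum>j<M. h j * saw (real (p * b) * midpoint M j)) / real p"
proof -
  define r where "r = b div gcd a b"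
  have ab: "a = p * gcd a b" "b = r * gcd a b" by (auto simp: p r_def)
  have p0: "p > 0" using M ab by (metis gr0I mult_0)
  have co: "coprime r p" unfolding p r_def using M
    by (metis coprime_commute div_gcd_coprime gr_implies_not_zero)
  obtain s where s: "M = a * s" using M by (auto simp: dvd_def)
  have sd: "M div a = s" using s M by simp
  have per': "h (j + i * s) = h j" for i j
  proof (induction i)
    case (Suc i)
    have "h (j + Suc i * s) = h ((j + i * s) + s)" by (simp add: algebra_simps)
    then show ?case using Suc per sd by simp
  qed simp
  have mid: "real b * midpoint M (j + i * s) = real b * midpoint M j + real (i * r) / real p" for i j
  proof -
    have "real b * real (i * s) / real M = real b * real i / real a"
      using s M by simp
    also have "\<dots> = real (i * r) / real p"
    proof -
      have "real b = real r * real (gcd a b)" "real a = real p * real (gcd a b)"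
        using ab by (metis of_nat_mult)+
      moreover have "gcd a b > 0" using M by simp
      ultimately show ?thesis using p0 M(4) by (simp add: field_simps)
    qed
    finally have "real b * real (i * s) / real M = real (i * r) / real p" .
    moreover have "real b * midpoint M (j + i * s) = real b * midpoint M j + real b * real (i * s) / real M"
      using M(1) by (simp add: midpoint_def field_simps)
    ultimately show ?thesis by simp
  qed
  let ?H = "\<lambda>j. h j * saw (real b * midpoint M j)"
  have perH: "?H (j + M) = ?H j" for j
  proof -
    have "h (j + M) = h j" using per'[of j a] s by simp
    moreover have "real b * midpoint M (j + M) = real b * midpoint M j + of_nat b"
      using M by (simp add: midpoint_def field_simps)
    ultimately show ?thesis by (simp only: saw_add_nat)
  qed
  have "real p * (\<Sum>j<M. ?H j) = (\<Sum>i<p. \<Sum>j<M. ?H (j + i * s))"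
    using sum_periodic_shift[of ?H M, OF perH] by simp
  also have "\<dots> = (\<Sum>j<M. h j * (\<Sum>i<p. saw (real b * midpoint M j + real (i * r) / real p)))"
    by (subst sum.swap) (simp add: per' mid sum_distrib_left)
  also have "\<dots> = (\<Sum>j<M. h j * saw (real (p * b) * midpoint M j))"
    using saw_distribution[OF p0 co] by (simp add: mult.assoc)
  finally show ?thesis using p0 by (simp add: field_simps)
qed

lemma saw_midpoint_periodic:
  assumes "M > 0" "a dvd M" "a > 0"
  shows "saw (real a * midpoint M (j + M div a)) = saw (real a * midpoint M j)"
proof -
  obtain s where s: "M = a * s" using assms by (auto simp: dvd_def)
  then have "real a * midpoint M (j + M div a) = real a * midpoint M j + of_int 1"
    using assms by (simp add: midpoint_def field_simps)
  then show ?thesis by (simp only: saw_add_int)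
qed

lemma ht_pos: "a > 0 \<Longrightarrow> b > 0 \<Longrightarrow> ht a b > 0"
  by (simp add: ht_def div_greater_zero_iff gcd_le1_nat gcd_le2_nat)

text \<open>Averaging twice raises both frequencies to the lcm \<open>L\<close>, at the cost of the
  factors 1/p and 1/r with \<open>p * r = ht a b\<close>. A sum of squares is left.\<close>

lemma sum_saw_product:
  assumes M: "M > 0" "a dvd M" "b dvd M" "a > 0" "b > 0"
  shows "(\<Sum>j<M. saw (real a * midpoint M j) * saw (real b * midpoint M j)) =
    real M / 12 * (1 / real (ht a b) - real a * real b / (real M)\<^sup>2)"
proof -
  define g p r where "g = gcd a b" "p = a div g" "r = b div g"
  have ab: "a = p * g" "b = r * g" by (auto simp: g_p_r_def)
  have g0: "g > 0" using M by (simp add: g_p_r_def)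
  have pr0: "p > 0" "r > 0" using M ab by (metis gr0I mult_0)+
  define L where "L = p * b"
  have L: "L = lcm a b" using M unfolding L_def g_p_r_def lcm_nat_def
    by (metis div_mult_swap gcd_dvd1 mult.commute)
  have LM: "L dvd M" using M L by simp
  have L': "L = r * a" by (simp add: L_def ab)
  have L0: "L > 0" using pr0 M by (simp add: L_def)
  obtain N where N: "M = L * N" using LM by (auto simp: dvd_def)
  have N0: "N > 0" using M N by (metis gr0I mult_0_right)
  have "(\<Sum>j<M. saw (real a * midpoint M j) * saw (real b * midpoint M j)) =
     (\<Sum>j<M. saw (real a * midpoint M j) * saw (real L * midpoint M j)) / real p"
    unfolding L_def
    by (rule sum_saw_average[OF M]) (auto simp: g_p_r_def intro!: saw_midpoint_periodic M)
  also have "(\<Sum>j<M. saw (real a * midpoint M j) * saw (real L * midpoint M j)) =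
     (\<Sum>j<M. saw (real L * midpoint M j) * saw (real a * midpoint M j))"
    by (simp add: mult.commute)
  also have "\<dots> = (\<Sum>j<M. saw (real L * midpoint M j) * saw (real L * midpoint M j)) / real r"
    unfolding L'
  proof (rule sum_saw_average[OF M(1,3,2,5,4)])
    show "r = b div gcd b a" by (simp add: g_p_r_def gcd.commute)
    fix j
    obtain s where s: "M = b * s" using M by (auto simp: dvd_def)
    have "real (r * a) * midpoint M (j + M div b) = real (r * a) * midpoint M j + of_nat p"
    proof -
      have "real (r * a) * real s / real M = real p"
        using s M ab by (simp add: field_simps)
      then show ?thesis using s M by (simp add: midpoint_def field_simps)
    qed
    then show "saw (real (r * a) * midpoint M (j + M div b)) = saw (real (r * a) * midpoint M j)"
      by (simp only: saw_add_nat)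
  qed
  \<comment> \<open>With \<open>M = L * N\<close>, the number \<open>L * midpoint M j\<close> is
    \<open>midpoint N j\<close>; as \<open>j\<close> runs below \<open>M\<close>, this passes
    through \<open>L\<close> full periods of length \<open>N\<close>.\<close>
  also have "(\<Sum>j<M. saw (real L * midpoint M j) * saw (real L * midpoint M j)) =
     (\<Sum>j<M. (saw (midpoint N j))\<^sup>2)"
    using M N L0 by (intro sum.cong) (auto simp: midpoint_def power2_eq_square)
  also have "\<dots> = (\<Sum>l<L. \<Sum>j<N. (saw (midpoint N j))\<^sup>2)"
  proof -
    have per: "saw (midpoint N (j + N)) = saw (midpoint N j)" for j
      using saw_midpoint_periodic[of N 1 j] N0 by simp
    have "(\<Sum>j<k * N. (saw (midpoint N j))\<^sup>2) = (\<Sum>l<k. \<Sum>j<N. (saw (midpoint N j))\<^sup>2)" for k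
    proof (induction k)
      case (Suc k)
      have "(\<Sum>j<Suc k * N. (saw (midpoint N j))\<^sup>2) = (\<Sum>j<k * N. (saw (midpoint N j))\<^sup>2) +
          (\<Sum>j<N. (saw (midpoint N (j + k * N)))\<^sup>2)"
      proof -
        have "{..<Suc k * N} = {..<k * N} \<union> {k * N..<k * N + N}" by auto
        then have "(\<Sum>j<Suc k * N. (saw (midpoint N j))\<^sup>2) = (\<Sum>j<k * N. (saw (midpoint N j))\<^sup>2) +
          (\<Sum>j\<in>{k * N..<k * N + N}. (saw (midpoint N j))\<^sup>2)"
          by (simp add: sum.union_disjoint ivl_disj_int)
        also have "(\<Sum>j\<in>{k * N..<k * N + N}. (saw (midpoint N j))\<^sup>2) =
          (\<Sum>j<N. (saw (midpoint N (j + k * N)))\<^sup>2)"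
          using sum.shift_bounds_nat_ivl[of "\<lambda>j. (saw (midpoint N j))\<^sup>2" 0 "k * N" N]
          by (simp add: atLeast0LessThan add.commute)
        finally show ?thesis .
      qed
      then show ?case
        using Suc sum_periodic_shift[of "\<lambda>j. (saw (midpoint N j))\<^sup>2" N "k * N"] per
        by (simp add: algebra_simps)
    qed simp
    then show ?thesis using N by simp
  qed
  also have "\<dots> = real L * (real N / 12 - 1 / (12 * real N))"
    using sum_saw_square[OF N0] by simp
  finally have *: "(\<Sum>j<M. saw (real a * midpoint M j) * saw (real b * midpoint M j)) =
    real L * (real N / 12 - 1 / (12 * real N)) / real r / real p" .
  have "ht a b = p * r" by (simp add: ht_def g_p_r_def)
  moreover have "real M = real L * real N" using N by simp
  moreover have "real L = real p * real r * real g" "real a = real p * real g" "real b = real r * real g"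
    using L_def ab by auto
  ultimately show ?thesis
    unfolding * using g0 pr0 N0 by (simp add: field_simps power2_eq_square)
qed

section \<open>The quadratic form\<close>

lemma gcd_cofactor_coprime:
  fixes a b :: nat
  assumes "a > 0" "b > 0"
  obtains g x y where "a = g * x" "b = g * y" "coprime x y" "g > 0" "x > 0" "y > 0"
    "a div gcd a b = x" "b div gcd a b = y" "ht a b = x * y"
proof
  show "a = gcd a b * (a div gcd a b)" "b = gcd a b * (b div gcd a b)" by auto
  show "coprime (a div gcd a b) (b div gcd a b)" using assms div_gcd_coprime by blast
qed (use assms in \<open>auto simp: ht_def div_greater_zero_iff gcd_le1_nat gcd_le2_nat\<close>)

lemma ht_cofactors:
  assumes "coprime x y" "g > 0"
  shows "ht (g * x) (g * y) = x * y"
  using assms by (simp add: ht_def gcd_mult_distrib_nat[symmetric])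

lemma ht_commute: "ht a b = ht b a"
  by (simp add: ht_def gcd.commute mult.commute)

lemma ht_self: "a > 0 \<Longrightarrow> ht a a = 1"
  by (simp add: ht_def)

lemma ht_eq_1: 
  assumes "a > 0" "b > 0" "ht a b = 1"
  shows "a = b"
  by (rule gcd_cofactor_coprime[OF assms(1,2)]) (use assms(3) in auto)

lemma ht_scale:
  assumes "k > 0"
  shows "ht (k * a) (k * b) = ht a b"
  using assms by (simp add: ht_def gcd_mult_distrib_nat[symmetric])

lemma ht_cong_ratio:
  assumes "a > 0" "b > 0" "a' > 0" "b' > 0" "a * b' = a' * b"
  shows "ht a b = ht a' b'"
proof -
  have "ht a b = ht (a' * a) (a' * b)" using assms by (simp add: ht_scale)
  also have "\<dots> = ht (a * a') (a * b')" unfolding assms(5) by (simp only: mult.commute)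
  also have "\<dots> = ht a' b'" using assms(1) by (rule ht_scale)
  finally show ?thesis .
qed

text \<open>The new prime either cancels against the reduced denominator of a/b or enters the
  numerator.\<close>

lemma ht_prime_mult:
  assumes "a > 0" "b > 0" "prime p"
  shows "ht (p * a) b = (if p dvd b div gcd a b then ht a b div p else p * ht a b)"
proof (cases rule: gcd_cofactor_coprime[OF assms(1,2)])
  case (1 g x y)
  note ab = 1(1,2) and co = 1(3) and pos = 1(4-6) and bg = 1(8) and h = 1(9)
  show ?thesis
  proof (cases "p dvd y")
    case True
    then obtain z where z: "y = p * z" by (auto simp: dvd_def)
    have "ht (p * a) b = ht ((p * g) * x) ((p * g) * z)" unfolding ab z by (simp add: ac_simps)
    also have "\<dots> = x * z"
      using co pos z assms by (intro ht_cofactors) (auto simp: prime_gt_0_nat)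
    finally show ?thesis using h z bg True assms(3) by (simp add: prime_gt_0_nat)
  next
    case False
    then have "coprime (p * x) y" using co assms(3) prime_imp_coprime by auto
    then have "ht (g * (p * x)) (g * y) = (p * x) * y" using pos by (intro ht_cofactors)
    moreover have "p * a = g * (p * x)" using ab(1) by simp
    ultimately have "ht (p * a) b = (p * x) * y" using ab(2) by metis
    then show ?thesis using bg False h by simp
  qed
qed

section \<open>Kernels sieved by a set of primes\<close>

text \<open>Sieving by more and more primes drives the kernel towards the identity matrix, because
  \<open>ht a b = 1\<close> only for \<open>a = b\<close>. The full kernel is
  \<open>kern {}\<close>.\<close>

definition kern :: "nat set \<Rightarrow> nat \<Rightarrow> nat \<Rightarrow> real" where
  "kern R a b = (if \<exists>p\<in>R. p dvd ht a b then 0 else 1 / real (ht a b))"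

lemma kern_scale: "k > 0 \<Longrightarrow> kern R (k * a) (k * b) = kern R a b"
  by (simp add: kern_def ht_scale)

text \<open>If \<open>p\<close> does not divide \<open>ht a b\<close>, both shifted kernels are
  \<open>kern R a b / p\<close>, and 1 + 1/p^2 - 2/p^2 = 1 - 1/p^2. If it does, one shift multiplies
  the kernel by \<open>p\<close> and the other divides it by \<open>p\<close>, so that the right
  side vanishes like the left one.\<close>

lemma kern_insert:
  assumes "a > 0" "b > 0" "prime p" "p \<notin> R" "\<forall>q\<in>R. prime q"
  shows "(1 - 1 / (real p)\<^sup>2) * kern (insert p R) a b =
    (1 + 1 / (real p)\<^sup>2) * kern R a b - (kern R (p * a) b + kern R a (p * b)) / real p"
proof (cases rule: gcd_cofactor_coprime[OF assms(1,2)])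
  case (1 g x y)
  have p0: "real p > 0" using assms by (simp add: prime_gt_0_nat)
  have bg: "b div gcd a b = y" "a div gcd b a = x"
    using 1(7,8) by (simp_all add: gcd.commute)
  have h1: "ht (p * a) b = (if p dvd y then ht a b div p else p * ht a b)"
    using ht_prime_mult[OF assms(1-3)] bg by simp
  have h2: "ht a (p * b) = (if p dvd x then ht a b div p else p * ht a b)"
    using ht_prime_mult[OF assms(2,1,3)] bg by (simp add: ht_commute)
  have qd: "q dvd p * n \<longleftrightarrow> q dvd n" if "q \<in> R" for q n
    using that assms by (metis prime_dvd_mult_eq_nat primes_dvd_imp_eq)
  have qp: "q dvd p * n \<longleftrightarrow> q dvd n" "p dvd n \<Longrightarrow> q dvd n div p \<longleftrightarrow> q dvd n" if "q \<in> R" for q n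
    using qd[OF that, of n] qd[OF that, of "n div p"] by auto
  have Rm: "(\<exists>q\<in>R. q dvd p * n) \<longleftrightarrow> (\<exists>q\<in>R. q dvd n)" for n using qp(1) by blast
  have Rd: "p dvd n \<Longrightarrow> (\<exists>q\<in>R. q dvd n div p) \<longleftrightarrow> (\<exists>q\<in>R. q dvd n)" for n using qp(2) by blast
  have km: "kern R a b / real p = (if \<exists>q\<in>R. q dvd p * ht a b then 0 else 1 / real (p * ht a b))"
    unfolding Rm by (simp add: kern_def field_simps)
  have kd: "p dvd ht a b \<Longrightarrow> kern R a b * real p =
     (if \<exists>q\<in>R. q dvd ht a b div p then 0 else 1 / real (ht a b div p))"
    using p0 by (simp only: Rd) (auto simp: kern_def real_of_nat_div)
  have pd: "p dvd ht a b \<longleftrightarrow> p dvd x \<or> p dvd y"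
    using 1(9) assms by (simp add: prime_dvd_mult_eq_nat)
  show ?thesis
  proof (cases "p dvd ht a b")
    case False
    then have "\<not> p dvd x" "\<not> p dvd y" using pd by auto
    then have "kern R (p * a) b = kern R a b / real p" "kern R a (p * b) = kern R a b / real p"
      unfolding km by (simp_all add: kern_def h1 h2)
    moreover have "kern (insert p R) a b = kern R a b" using False by (simp add: kern_def)
    ultimately show ?thesis using p0 by (simp add: field_simps power2_eq_square)
  next
    case True
    have "kern (insert p R) a b = 0" using True by (simp add: kern_def)
    moreover have "\<not> (p dvd x \<and> p dvd y)"
      using 1(3) assms(3) by (metis not_coprimeI not_prime_unit)
    then consider "p dvd x" "\<not> p dvd y" | "p dvd y" "\<not> p dvd x" using pd True by auto
    then have "kern R (p * a) b + kern R a (p * b) = kern R a b / real p + kern R a b * real p"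
    proof cases
      case 1
      then show ?thesis using True unfolding km kd[OF True] unfolding kern_def h1 h2 by simp
    next
      case 2
      then show ?thesis using True unfolding km kd[OF True] unfolding kern_def h1 h2 by simp
    qed
    ultimately show ?thesis using p0 by (simp add: field_simps power2_eq_square)
  qed
qed

definition qform :: "nat set \<Rightarrow> nat set \<Rightarrow> (nat \<Rightarrow> real) \<Rightarrow> real" where
  "qform R C m = (\<Sum>a\<in>C. \<Sum>b\<in>C. m a * m b * kern R a b)"

lemma sum_swap3:
  "(\<Sum>a\<in>A. \<Sum>b\<in>B. \<Sum>w\<in>W. h a b w) = (\<Sum>w\<in>W. \<Sum>a\<in>A. \<Sum>b\<in>B. h a b w)"
proof -
  have "(\<Sum>a\<in>A. \<Sum>b\<in>B. \<Sum>w\<in>W. h a b w) = (\<Sum>a\<in>A. \<Sum>w\<in>W. \<Sum>b\<in>B. h a b w)"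
    by (intro sum.cong refl sum.swap)
  also have "\<dots> = (\<Sum>w\<in>W. \<Sum>a\<in>A. \<Sum>b\<in>B. h a b w)" by (rule sum.swap)
  finally show ?thesis .
qed

lemma kern_empty: "kern {} a b = 1 / real (ht a b)"
  by (simp add: kern_def)

lemma sum_sawtooth_square:
  assumes C: "finite C" "\<And>c. c \<in> C \<Longrightarrow> c > 0 \<and> c dvd M" and "M > 0"
  shows "(\<Sum>j<M. (\<Sum>c\<in>C. m c * saw (real c * midpoint M j))\<^sup>2) =
    real M / 12 * (qform {} C m - (\<Sum>c\<in>C. m c * real c)\<^sup>2 / (real M)\<^sup>2)"
proof -
  have "(\<Sum>j<M. (\<Sum>c\<in>C. m c * saw (real c * midpoint M j))\<^sup>2) =
     (\<Sum>j<M. \<Sum>a\<in>C. \<Sum>b\<in>C. m a * m b * (saw (real a * midpoint M j) * saw (real b * midpoint M j)))"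
    by (simp add: power2_eq_square sum_product ac_simps)
  also have "\<dots> = (\<Sum>a\<in>C. \<Sum>b\<in>C. m a * m b *
      (\<Sum>j<M. saw (real a * midpoint M j) * saw (real b * midpoint M j)))"
    unfolding sum_distrib_left by (rule sum_swap3[symmetric])
  also have "\<dots> = (\<Sum>a\<in>C. \<Sum>b\<in>C. m a * m b *
      (real M / 12 * (1 / real (ht a b) - real a * real b / (real M)\<^sup>2)))"
    using C assms(3) by (intro sum.cong refl) (simp add: sum_saw_product)
  also have "\<dots> = real M / 12 * (\<Sum>a\<in>C. \<Sum>b\<in>C. m a * m b * kern {} a b -
      (m a * real a) * (m b * real b) / (real M)\<^sup>2)"
    by (simp add: sum_distrib_left kern_empty algebra_simps)
  also have "\<dots> = real M / 12 * (qform {} C m - (\<Sum>c\<in>C. m c * real c)\<^sup>2 / (real M)\<^sup>2)"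
    by (simp add: qform_def sum_subtractf power2_eq_square sum_product sum_divide_distrib)
  finally show ?thesis .
qed

section \<open>Gram vectors, semidefiniteness and the cost of sieving\<close>

text \<open>Positive semidefiniteness, with explicit vectors \<open>f a\<close> for each finite set
  of positive numbers. The vectors themselves are needed, since new ones are built from them when a
  prime is added to \<open>R\<close>.\<close>

definition gram :: "(nat \<Rightarrow> nat \<Rightarrow> real) \<Rightarrow> bool" where
  "gram k \<longleftrightarrow> (\<forall>C. finite C \<and> (\<forall>c\<in>C. c > 0) \<longrightarrow>
     (\<exists>(W::nat set) f. finite W \<and> (\<forall>a\<in>C. \<forall>b\<in>C. k a b = (\<Sum>w\<in>W. f a w * f b w))))"

text \<open>The coordinates \<open>w < M\<close> are the scaled samples of the sawtooth. The
  additional coordinate \<open>a / M\<close> at \<open>w = M\<close> compensates the correction term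
  of \<open>sum_saw_product\<close>.\<close>

lemma gram_kern_empty: "gram (kern {})"
  unfolding gram_def
proof (intro allI impI)
  fix C :: "nat set" assume C: "finite C \<and> (\<forall>c\<in>C. c > 0)"
  define M where "M = (\<Prod>c\<in>C. c)"
  have M0: "M > 0" using C by (auto simp: M_def)
  have CM: "c dvd M" if "c \<in> C" for c using C that unfolding M_def by (intro dvd_prodI) auto
  define f where "f = (\<lambda>a w. if w < M then sqrt (12 / real M) * saw (real a * midpoint M w)
                             else real a / real M)"
  have "kern {} a b = (\<Sum>w\<in>{..M}. f a w * f b w)" if "a \<in> C" "b \<in> C" for a b
  proof -
    have "(\<Sum>w\<in>{..M}. f a w * f b w) = (\<Sum>w<M. f a w * f b w) + f a M * f b M"
      by (simp add: lessThan_Suc_atMost[symmetric])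
    also have "(\<Sum>w<M. f a w * f b w) =
        12 / real M * (\<Sum>w<M. saw (real a * midpoint M w) * saw (real b * midpoint M w))"
      unfolding sum_distrib_left by (intro sum.cong refl) (auto simp: f_def field_simps)
    also have "\<dots> = 1 / real (ht a b) - real a * real b / (real M)\<^sup>2"
      using C CM M0 that by (subst sum_saw_product) auto
    finally show ?thesis by (simp add: f_def kern_empty power2_eq_square)
  qed
  then show "\<exists>(W::nat set) f. finite W \<and> (\<forall>a\<in>C. \<forall>b\<in>C. kern {} a b = (\<Sum>w\<in>W. f a w * f b w))"
    by (intro exI[of _ "{..M}"] exI[of _ f]) auto
qed

text \<open>The vectors \<open>f (p * a) - f a / p\<close>, normalized by the square root of 1 -
  1/p^2, have the inner products prescribed by \<open>kern_insert\<close>. The old vectors are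
  therefore taken on \<open>C\<close> together with its multiples by \<open>p\<close>.\<close>

lemma gram_kern_insert:
  assumes "gram (kern R)" "prime p" "p \<notin> R" "\<forall>q\<in>R. prime q"
  shows "gram (kern (insert p R))"
  unfolding gram_def
proof (intro allI impI)
  fix C :: "nat set" assume C: "finite C \<and> (\<forall>c\<in>C. c > 0)"
  have p: "real p > 1" using prime_gt_1_nat[OF assms(2)] by simp
  have "finite (C \<union> (*) p ` C) \<and> (\<forall>c\<in>C \<union> (*) p ` C. c > 0)"
    using C assms(2) by (auto simp: prime_gt_0_nat)
  then obtain W :: "nat set" and f where W: "finite W"
    "\<And>a b. a \<in> C \<union> (*) p ` C \<Longrightarrow> b \<in> C \<union> (*) p ` C \<Longrightarrow> kern R a b = (\<Sum>w\<in>W. f a w * f b w)"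
    using assms(1) unfolding gram_def by meson
  define q where "q = 1 - 1 / (real p)\<^sup>2"
  have q: "q > 0" using p by (simp add: q_def)
  define g where "g = (\<lambda>a w. (f (p * a) w - f a w / real p) / sqrt q)"
  have "kern (insert p R) a b = (\<Sum>w\<in>W. g a w * g b w)" if "a \<in> C" "b \<in> C" for a b
  proof -
    have "q * (\<Sum>w\<in>W. g a w * g b w) =
       (\<Sum>w\<in>W. (f (p * a) w - f a w / real p) * (f (p * b) w - f b w / real p))"
      unfolding sum_distrib_left using q by (intro sum.cong refl) (simp add: g_def)
    also have "\<dots> = (\<Sum>w\<in>W. f (p * a) w * f (p * b) w + f a w * f b w / (real p)\<^sup>2 -
        (f (p * a) w * f b w + f a w * f (p * b) w) / real p)"
      using p by (intro sum.cong refl) (simp add: field_simps power2_eq_square)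
    also have "\<dots> = kern R (p * a) (p * b) + kern R a b / (real p)\<^sup>2 -
        (kern R (p * a) b + kern R a (p * b)) / real p"
    proof -
      have "a \<in> C \<union> (*) p ` C" "b \<in> C \<union> (*) p ` C" "p * a \<in> C \<union> (*) p ` C" "p * b \<in> C \<union> (*) p ` C"
        using that by auto
      note W(2)[OF this(3,4)] W(2)[OF this(1,2)] W(2)[OF this(3,2)] W(2)[OF this(1,4)]
      then show ?thesis by (simp only: sum.distrib sum_subtractf sum_divide_distrib add_divide_distrib)
    qed
    also have "\<dots> = q * kern (insert p R) a b"
      using kern_insert[of a b p R] kern_scale[of p R a b] that C assms(2-4) p
      by (simp add: q_def field_simps)
    finally show ?thesis using q by simp
  qed
  then show "\<exists>(W::nat set) f. finite W \<and>
      (\<forall>a\<in>C. \<forall>b\<in>C. kern (insert p R) a b = (\<Sum>w\<in>W. f a w * f b w))"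
    using W(1) by (intro exI[of _ W] exI[of _ g]) auto
qed

lemma gram_kern:
  assumes "finite R" "\<forall>q\<in>R. prime q"
  shows "gram (kern R)"
  using assms by (induction R) (auto intro: gram_kern_insert gram_kern_empty)

lemma qform_nonneg:
  assumes "finite R" "\<forall>q\<in>R. prime q" "finite C" "\<forall>c\<in>C. c > 0"
  shows "qform R C m \<ge> 0"
proof -
  obtain W :: "nat set" and f where W: "finite W"
    "\<And>a b. a \<in> C \<Longrightarrow> b \<in> C \<Longrightarrow> kern R a b = (\<Sum>w\<in>W. f a w * f b w)"
    using gram_kern[OF assms(1,2)] assms(3,4) unfolding gram_def by meson
  have "qform R C m = (\<Sum>a\<in>C. \<Sum>b\<in>C. \<Sum>w\<in>W. (m a * f a w) * (m b * f b w))"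
    unfolding qform_def using W by (intro sum.cong refl) (simp add: sum_distrib_left ac_simps)
  also have "\<dots> = (\<Sum>w\<in>W. \<Sum>a\<in>C. \<Sum>b\<in>C. (m a * f a w) * (m b * f b w))"
    by (rule sum_swap3)
  also have "\<dots> = (\<Sum>w\<in>W. (\<Sum>a\<in>C. m a * f a w)\<^sup>2)"
    by (simp add: power2_eq_square sum_product)
  finally show ?thesis by (simp add: sum_nonneg)
qed

text \<open>Up to the factor \<open>1 - p\<^sup>-\<^sup>2\<close>, the form for \<open>insert p R\<close> is the form for \<open>R\<close> evaluated at
  \<open>f(p x) - f(x)/p\<close>, and \<open>f(p x)\<close> has the same norm as \<open>f(x)\<close>.\<close>

lemma qform_insert_le:
  assumes "finite R" "\<forall>q\<in>R. prime q" "finite C" "\<forall>c\<in>C. c > 0" "prime p" "p \<notin> R"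
  shows "qform (insert p R) C m \<le> (real p + 1) / (real p - 1) * qform R C m"
proof -
  have p: "real p > 1" using prime_gt_1_nat[OF assms(5)] by simp
  have "finite (C \<union> (*) p ` C) \<and> (\<forall>c\<in>C \<union> (*) p ` C. c > 0)"
    using assms by (auto simp: prime_gt_0_nat)
  then obtain W :: "nat set" and f where W: "finite W"
    "\<And>a b. a \<in> C \<union> (*) p ` C \<Longrightarrow> b \<in> C \<union> (*) p ` C \<Longrightarrow> kern R a b = (\<Sum>w\<in>W. f a w * f b w)"
    using gram_kern[OF assms(1,2)] unfolding gram_def by meson
  have expand: "(\<Sum>a\<in>C. \<Sum>b\<in>C. m a * m b * kern R (s * a) (t * b)) =
      (\<Sum>w\<in>W. (\<Sum>a\<in>C. m a * f (s * a) w) * (\<Sum>b\<in>C. m b * f (t * b) w))"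
    if "s \<in> {1, p}" "t \<in> {1, p}" for s t
  proof -
    have "(\<Sum>a\<in>C. \<Sum>b\<in>C. m a * m b * kern R (s * a) (t * b)) =
       (\<Sum>a\<in>C. \<Sum>b\<in>C. \<Sum>w\<in>W. (m a * f (s * a) w) * (m b * f (t * b) w))"
    proof (intro sum.cong refl)
      fix a b assume "a \<in> C" "b \<in> C"
      then have "kern R (s * a) (t * b) = (\<Sum>w\<in>W. f (s * a) w * f (t * b) w)"
        using that by (intro W) auto
      then show "m a * m b * kern R (s * a) (t * b) =
          (\<Sum>w\<in>W. (m a * f (s * a) w) * (m b * f (t * b) w))"
        by (simp add: sum_distrib_left ac_simps)
    qed
    also have "\<dots> = (\<Sum>w\<in>W. \<Sum>a\<in>C. \<Sum>b\<in>C. (m a * f (s * a) w) * (m b * f (t * b) w))"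
      by (rule sum_swap3)
    finally show ?thesis by (simp add: sum_product)
  qed
  define u where "u = (\<lambda>w. \<Sum>a\<in>C. m a * f (p * a) w)"
  define v where "v = (\<lambda>w. \<Sum>a\<in>C. m a * f a w)"
  have Qv: "qform R C m = (\<Sum>w\<in>W. (v w)\<^sup>2)"
    using expand[of 1 1] by (simp add: qform_def v_def power2_eq_square)
  have Qu: "qform R C m = (\<Sum>w\<in>W. (u w)\<^sup>2)"
    using expand[of p p] p by (simp add: qform_def u_def power2_eq_square kern_scale)
  have uv: "(\<Sum>a\<in>C. \<Sum>b\<in>C. m a * m b * kern R (p * a) b) = (\<Sum>w\<in>W. u w * v w)"
           "(\<Sum>a\<in>C. \<Sum>b\<in>C. m a * m b * kern R a (p * b)) = (\<Sum>w\<in>W. u w * v w)"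
    using expand[of p 1] expand[of 1 p] by (simp_all add: u_def v_def mult.commute)
  have "(1 - 1 / (real p)\<^sup>2) * qform (insert p R) C m = (\<Sum>a\<in>C. \<Sum>b\<in>C. m a * m b *
      ((1 + 1 / (real p)\<^sup>2) * kern R a b - (kern R (p * a) b + kern R a (p * b)) / real p))"
    unfolding qform_def sum_distrib_left using assms
    by (intro sum.cong refl) (simp add: kern_insert[symmetric])
  also have "\<dots> = (1 + 1 / (real p)\<^sup>2) * qform R C m -
      ((\<Sum>a\<in>C. \<Sum>b\<in>C. m a * m b * kern R (p * a) b) +
       (\<Sum>a\<in>C. \<Sum>b\<in>C. m a * m b * kern R a (p * b))) / real p"
    unfolding qform_def
    by (simp add: sum_distrib_left sum_divide_distrib sum_subtractf[symmetric] sum.distrib[symmetric]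
      algebra_simps add_divide_distrib)
  also have "\<dots> = (1 + 1 / (real p)\<^sup>2) * qform R C m - 2 * (\<Sum>w\<in>W. u w * v w) / real p"
    by (simp add: uv)
  \<comment> \<open>The vectors \<open>u\<close> and \<open>v\<close> have the same squared norm
    \<open>qform R C m\<close>, so expanding the square of \<open>u + v\<close> bounds the cross
    term.\<close>
  also have "- 2 * (\<Sum>w\<in>W. u w * v w) \<le> 2 * qform R C m"
  proof -
    have "0 \<le> (\<Sum>w\<in>W. (u w + v w)\<^sup>2)" by (simp add: sum_nonneg)
    also have "\<dots> = 2 * qform R C m + 2 * (\<Sum>w\<in>W. u w * v w)"
      using Qu Qv by (simp add: power2_sum sum.distrib sum_distrib_left mult.assoc)
    finally show ?thesis by simp
  qed
  then have "(1 + 1 / (real p)\<^sup>2) * qform R C m - 2 * (\<Sum>w\<in>W. u w * v w) / real p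
     \<le> (1 + 1 / (real p)\<^sup>2) * qform R C m + 2 * qform R C m / real p"
  proof -
    have "(- 2 * (\<Sum>w\<in>W. u w * v w)) / real p \<le> (2 * qform R C m) / real p"
      using \<open>- 2 * _ \<le> _\<close> p by (intro divide_right_mono) auto
    then show ?thesis by simp
  qed
  \<comment> \<open>The bound is (1 + 1/p)^2 times the form, and (1 + 1/p)^2 = (1 - 1/p^2) (p +
    1)/(p - 1).\<close>
  also have "\<dots> = (1 - 1 / (real p)\<^sup>2) * ((real p + 1) / (real p - 1) * qform R C m)"
    using p by (simp add: divide_simps power2_eq_square) (simp add: algebra_simps)
  finally have "(1 - 1 / (real p)\<^sup>2) * qform (insert p R) C m
     \<le> (1 - 1 / (real p)\<^sup>2) * ((real p + 1) / (real p - 1) * qform R C m)" by simp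
  moreover have "1 - 1 / (real p)\<^sup>2 > 0" using p by simp
  ultimately show ?thesis by (simp only: mult_le_cancel_left_pos)
qed

lemma qform_le_prod:
  assumes "finite R" "\<forall>q\<in>R. prime q" "finite C" "\<forall>c\<in>C. c > 0"
  shows "qform R C m \<le> (\<Prod>p\<in>R. (real p + 1) / (real p - 1)) * qform {} C m"
  using assms(1,2)
proof (induction R)
  case (insert p R)
  have p: "real p > 1" using prime_gt_1_nat[of p] insert by simp
  have "qform (insert p R) C m \<le> (real p + 1) / (real p - 1) * qform R C m"
    using insert assms by (intro qform_insert_le) auto
  also have "\<dots> \<le> (real p + 1) / (real p - 1) *
      ((\<Prod>p\<in>R. (real p + 1) / (real p - 1)) * qform {} C m)"
    using insert p by (intro mult_left_mono) auto
  finally show ?case using insert by (simp add: mult.assoc)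
qed simp

lemma prime_factor_gt:
  fixes n P :: nat
  assumes "n > 1" "\<forall>p\<in>{p. prime p \<and> p \<le> P}. \<not> p dvd n"
  shows "n > P"
proof -
  obtain q where "prime q" "q dvd n" using assms(1) prime_factor_nat[of n] by auto
  moreover from this have "q \<le> n" using assms(1) by (auto dest: dvd_imp_le)
  ultimately show ?thesis using assms(2) by auto
qed

text \<open>Off the diagonal \<open>ht a b\<close> exceeds 1: either one of its prime factors is at
  most \<open>P\<close> and the kernel vanishes, or all of them exceed \<open>P\<close> and the
  kernel is below 1/P.\<close>

lemma kern_primes_le:
  assumes "a > 0" "b > 0" "P > 0"
  shows "\<bar>kern {p. prime p \<and> p \<le> P} a b - (if a = b then 1 else 0)\<bar> \<le> 1 / real P"
proof (cases "a = b")
  case True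
  then show ?thesis using assms by (auto simp: kern_def ht_self)
next
  case False
  then have "ht a b > 1" using assms ht_eq_1 ht_pos by (metis less_one linorder_neqE_nat neq0_conv)
  then show ?thesis
    using prime_factor_gt[of "ht a b" P] assms False by (auto simp: kern_def field_simps)
qed

text \<open>By \<open>kern_primes_le\<close> the sieved kernel differs from the identity by at most
  1/P in each entry, so its form is nearly the sum of squares.\<close>

lemma qform_primes_ge:
  assumes "finite C" "\<forall>c\<in>C. c > 0" "P > 0"
  shows "qform {p. prime p \<and> p \<le> P} C m \<ge> (\<Sum>c\<in>C. (m c)\<^sup>2) - (\<Sum>c\<in>C. \<bar>m c\<bar>)\<^sup>2 / real P"
proof -
  define R where "R = {p::nat. prime p \<and> p \<le> P}"
  have "(\<Sum>c\<in>C. (m c)\<^sup>2) - qform R C m =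
      (\<Sum>a\<in>C. \<Sum>b\<in>C. m a * m b * ((if a = b then 1 else 0) - kern R a b))"
  proof -
    have "(\<Sum>c\<in>C. (m c)\<^sup>2) = (\<Sum>a\<in>C. \<Sum>b\<in>C. m a * m b * (if a = b then 1 else 0))"
      using assms(1) by (intro sum.cong refl) (simp add: power2_eq_square if_distrib cong: if_cong)
    then show ?thesis by (simp add: qform_def right_diff_distrib sum_subtractf)
  qed
  also have "\<dots> \<le> (\<Sum>a\<in>C. \<Sum>b\<in>C. \<bar>m a\<bar> * \<bar>m b\<bar> * (1 / real P))"
  proof (intro sum_mono)
    fix a b assume ab: "a \<in> C" "b \<in> C"
    have "m a * m b * ((if a = b then 1 else 0) - kern R a b) \<le>
        \<bar>m a * m b * ((if a = b then 1 else 0) - kern R a b)\<bar>" by simp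
    also have "\<dots> \<le> \<bar>m a\<bar> * \<bar>m b\<bar> * (1 / real P)"
      unfolding abs_mult using kern_primes_le[of a b P] ab assms
      by (intro mult_left_mono) (auto simp: R_def abs_minus_commute)
    finally show "m a * m b * ((if a = b then 1 else 0) - kern R a b) \<le> \<bar>m a\<bar> * \<bar>m b\<bar> * (1 / real P)" .
  qed
  also have "\<dots> = (\<Sum>c\<in>C. \<bar>m c\<bar>)\<^sup>2 / real P"
    by (simp add: power2_eq_square sum_product sum_divide_distrib)
  finally show ?thesis by (simp add: R_def)
qed

text \<open>If the full form vanishes, sieving bounds every sieved form by 0 as well, and
  \<open>qform_primes_ge\<close> gives \<open>A <= B / P\<close> for each positive \<open>P\<close>.
  A large \<open>P\<close> contradicts \<open>A > 0\<close>.\<close>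

lemma qform_definite:
  assumes "finite C" "\<forall>c\<in>C. c > 0" "qform {} C m = 0" "c \<in> C"
  shows "m c = 0"
proof (rule ccontr)
  assume "m c \<noteq> 0"
  define A B where "A = (\<Sum>c\<in>C. (m c)\<^sup>2)" "B = (\<Sum>c\<in>C. \<bar>m c\<bar>)\<^sup>2"
  have A: "A > 0" unfolding A_B_def using assms \<open>m c \<noteq> 0\<close> by (intro sum_pos2[of C c]) auto
  obtain P :: nat where P: "real P > B / A" using reals_Archimedean2 by blast
  have "B \<ge> 0" by (simp add: A_B_def)
  then have P0: "P > 0" using P A by (cases P) (auto simp: divide_less_0_iff)
  have fin: "finite {p::nat. prime p \<and> p \<le> P}" by simp
  have "A - B / real P \<le> qform {p. prime p \<and> p \<le> P} C m"
    unfolding A_B_def using assms P0 by (intro qform_primes_ge) auto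
  also have "\<dots> \<le> (\<Prod>p\<in>{p. prime p \<and> p \<le> P}. (real p + 1) / (real p - 1)) * qform {} C m"
    using assms fin by (intro qform_le_prod) auto
  finally have "A \<le> B / real P" using assms by simp
  then show False using P P0 A by (simp add: field_simps)
qed

section \<open>Growth of the product over primes\<close>

lemma prime_mod_6:
  fixes p :: nat
  assumes "prime p" "p > 3"
  shows "p mod 6 = 1 \<or> p mod 6 = 5"
proof -
  have "\<not> 2 dvd p" "\<not> 3 dvd p" using assms
    by (auto dest: primes_dvd_imp_eq[rotated 2])
  then show ?thesis by presburger
qed

text \<open>Only the residues \<open>\<plusminus>1\<close> modulo 6 contribute, so the product grows at most like \<open>t\<close> to the
  power \<open>2/3\<close>, which is less than linear.\<close>

lemma prod_primes_cube_le:
  "(\<Prod>p\<in>{p::nat. prime p \<and> p \<le> 6 * t + 7}. (real p + 1) / (real p - 1)) ^ 3 \<le> 108 * (3 * real t + 4)\<^sup>2"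
proof (induction t)
  \<comment> \<open>The constant 108 makes this an equality: the product over 2, 3, 5, 7 is 12, and
    12^3 = 108 * 4^2.\<close>
  case 0
  have "{p::nat. prime p \<and> p \<le> 7} = {2, 3, 5, 7}"
  proof -
    have "p \<in> {2, 3, 5, 7}" if "prime p" "p \<le> 7" for p :: nat
    proof -
      have "p \<noteq> 4" "p \<noteq> 6" using that(1) prime_odd_nat[of p] by auto
      moreover have "p \<ge> 2" using that(1) by (simp add: prime_ge_2_nat)
      ultimately show ?thesis using that(2) by auto
    qed
    moreover have "prime (2::nat)" "prime (3::nat)" "prime (5::nat)" "prime (7::nat)" by simp_all
    ultimately show ?thesis by auto
  qed
  then show ?case by simp
next
  case (Suc t)
  let ?f = "\<lambda>p::nat. (real p + 1) / (real p - 1)"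
  let ?S = "\<lambda>n. {p::nat. prime p \<and> p \<le> n}"
  define a b where "a = 6 * t + 11" "b = 6 * t + 13"
  define g where "g = (\<Prod>p\<in>?S (6 * t + 7). ?f p)"
  have g0: "g \<ge> 0" unfolding g_def
    by (intro prod_nonneg) (auto dest: prime_gt_1_nat)
  have sub: "?S (6 * Suc t + 7) \<subseteq> ?S (6 * t + 7) \<union> {a, b}"
  proof
    fix p assume "p \<in> ?S (6 * Suc t + 7)"
    then have p: "prime p" "p \<le> 6 * t + 13" by auto
    show "p \<in> ?S (6 * t + 7) \<union> {a, b}"
    proof (cases "p \<le> 6 * t + 7")
      case False
      then have "p mod 6 = 1 \<or> p mod 6 = 5" using prime_mod_6 p by auto
      then have "p = 6 * t + 11 \<or> p = 6 * t + 13" using p(2) False by presburger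
      then show ?thesis by (auto simp: a_b_def)
    qed (use p in auto)
  qed
  have "(\<Prod>p\<in>?S (6 * Suc t + 7). ?f p) \<le> (\<Prod>p\<in>?S (6 * t + 7) \<union> {a, b}. ?f p)"
  proof (rule prod_mono2)
    show "1 \<le> ?f p" if "p \<in> ?S (6 * t + 7) \<union> {a, b} - ?S (6 * Suc t + 7)" for p
      using that by (auto simp: a_b_def field_simps dest: prime_gt_1_nat)
    show "0 \<le> ?f p" if "p \<in> ?S (6 * Suc t + 7)" for p
      using that by (auto dest: prime_gt_1_nat)
  qed (use sub in auto)
  also have "\<dots> = g * (?f a * ?f b)"
    unfolding g_def by (subst prod.union_disjoint) (auto simp: a_b_def)
  \<comment> \<open>As \<open>b = a + 2\<close>, the numerator \<open>a + 1\<close> cancels against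
    the denominator \<open>b - 1\<close>.\<close>
  also have "?f a * ?f b = (3 * real t + 7) / (3 * real t + 5)"
    by (simp add: a_b_def divide_simps) (simp add: algebra_simps)
  finally have le: "(\<Prod>p\<in>?S (6 * Suc t + 7). ?f p) \<le> g * ((3 * real t + 7) / (3 * real t + 5))" .
  have "(\<Prod>p\<in>?S (6 * Suc t + 7). ?f p) ^ 3 \<le> (g * ((3 * real t + 7) / (3 * real t + 5))) ^ 3"
    by (intro power_mono le prod_nonneg) (auto dest: prime_gt_1_nat)
  also have "\<dots> = g ^ 3 * ((3 * real t + 7) / (3 * real t + 5)) ^ 3"
    by (rule power_mult_distrib)
  also have "\<dots> \<le> (108 * (3 * real t + 4)\<^sup>2) * ((3 * real t + 7) / (3 * real t + 5)) ^ 3"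
    using Suc.IH by (intro mult_right_mono) (auto simp: g_def)
  also have "\<dots> \<le> 108 * (3 * real (Suc t) + 4)\<^sup>2"
  proof -
    define v where "v = 3 * real t + 5"
    have v: "v > 0" by (simp add: v_def)
    \<comment> \<open>The left side is v^3 - 3v + 2.\<close>
    have "(v - 1)\<^sup>2 * (v + 2) \<le> v ^ 3"
      using v by (simp add: power2_eq_square power3_eq_cube algebra_simps) (simp add: v_def)
    then have "(v - 1)\<^sup>2 * (v + 2) * (v + 2)\<^sup>2 \<le> v ^ 3 * (v + 2)\<^sup>2"
      by (intro mult_right_mono) auto
    then have "(v - 1)\<^sup>2 * ((v + 2) / v) ^ 3 \<le> (v + 2)\<^sup>2"
      using v by (simp add: power_divide divide_simps power3_eq_cube power2_eq_square ac_simps)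
    then show ?thesis by (simp add: v_def algebra_simps)
  qed
  finally show ?case .
qed

section \<open>Least forms among sawtooth sums congruent modulo 1\<close>

text \<open>The floor part is an integer, so modulo 1 the sum depends only on the slope and on the
  parity of the total multiplicity.\<close>

lemma saw_combination_cong:
  fixes m :: "nat \<Rightarrow> int"
  shows "(\<Sum>c\<in>C. m c * saw (real c * x)) =
     real_of_int (\<Sum>c\<in>C. m c) / 2 - real_of_int (\<Sum>c\<in>C. m c * int c) * x
     + real_of_int (\<Sum>c\<in>C. m c * \<lfloor>real c * x\<rfloor>)"
proof -
  have "(\<Sum>c\<in>C. m c * saw (real c * x)) =
      (\<Sum>c\<in>C. real_of_int (m c) / 2 - real_of_int (m c * int c) * x + real_of_int (m c * \<lfloor>real c * x\<rfloor>))"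
    by (intro sum.cong refl) (simp add: saw_def frac_def algebra_simps)
  then show ?thesis
    by (simp add: sum.distrib sum_subtractf sum_divide_distrib sum_distrib_right)
qed

lemma midpoint_not_int:
  assumes "M > 0" "c dvd M" "c > 0"
  shows "real c * midpoint M j \<notin> \<int>"
proof
  assume "real c * midpoint M j \<in> \<int>"
  then obtain k where k: "real c * midpoint M j = of_int k" by (auto elim: Ints_cases)
  obtain s where s: "M = c * s" using assms by (auto simp: dvd_def)
  have "s > 0" using s assms by (cases s) auto
  have "real c * midpoint M j = (2 * real j + 1) / (2 * real s)"
    using s assms(3) by (simp add: midpoint_def)
  then have "2 * real j + 1 = 2 * real s * of_int k"
    using k \<open>s > 0\<close> by (simp add: field_simps)
  then have "real_of_int (2 * int j + 1) = real_of_int (2 * (int s * k))" by simp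
  then have "2 * int j + 1 = 2 * (int s * k)" by (simp only: of_int_eq_iff)
  then show False by presburger
qed

lemma qform_superset:
  assumes "finite D" "C \<subseteq> D" "\<And>c. c \<in> D - C \<Longrightarrow> m c = 0"
  shows "qform R D m = qform R C m"
proof -
  have "qform R D m = (\<Sum>a\<in>D. \<Sum>b\<in>C. m a * m b * kern R a b)"
    unfolding qform_def using assms by (intro sum.cong refl sum.mono_neutral_right) auto
  also have "\<dots> = qform R C m"
    unfolding qform_def using assms by (intro sum.mono_neutral_right) auto
  finally show ?thesis .
qed

lemma int_square_add_ge:
  fixes k :: int and s :: real
  assumes "\<bar>s\<bar> < 1/2"
  shows "s\<^sup>2 \<le> (k + s)\<^sup>2" "(k + s)\<^sup>2 = s\<^sup>2 \<Longrightarrow> k = 0"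
proof -
  have *: "s\<^sup>2 < (k + s)\<^sup>2" if "k \<noteq> 0"
  proof -
    have "\<bar>real_of_int k\<bar> \<ge> 1" using that by linarith
    then have "\<bar>s\<bar> < \<bar>k + s\<bar>" using assms by linarith
    then show ?thesis by (metis abs_ge_zero power2_abs power_strict_mono zero_less_numeral)
  qed
  show "s\<^sup>2 \<le> (k + s)\<^sup>2" using * by (cases "k = 0") auto
  show "(k + s)\<^sup>2 = s\<^sup>2 \<Longrightarrow> k = 0" using * by (cases "k = 0") auto
qed

lemma frac_gt_0: "y \<notin> \<int> \<Longrightarrow> 0 < frac y"
  using frac_ge_0[of y] frac_eq_0_iff[of y] by linarith

lemma abs_saw_less: "y \<notin> \<int> \<Longrightarrow> \<bar>saw y\<bar> < 1/2"
  using frac_gt_0[of y] frac_lt_1[of y] unfolding saw_def abs_less_iff by linarith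

text \<open>With \<open>t = frac y\<close> the difference is -t for t < 1/2 and 1 - t for t >
  1/2.\<close>

lemma abs_saw_double_less:
  assumes "y \<notin> \<int>" "2 * y \<notin> \<int>"
  shows "\<bar>saw (2 * y) - saw y\<bar> < 1/2"
proof -
  define t where "t = frac y"
  have t: "0 < t" "t < 1" using assms frac_gt_0 frac_lt_1 by (auto simp: t_def)
  have y: "y = t + of_int \<lfloor>y\<rfloor>" by (simp add: t_def frac_def)
  have tn: "2 * t \<noteq> 1"
  proof
    assume "2 * t = 1"
    then have "2 * y = of_int (1 + 2 * \<lfloor>y\<rfloor>)" using y by simp
    then show False using assms(2) by (metis Ints_of_int)
  qed
  have "frac (2 * y) = frac (2 * t + of_int (2 * \<lfloor>y\<rfloor>))" by (subst y) simp
  also have "\<dots> = frac (2 * t)" by (simp only: frac_def floor_add_int of_int_add) simp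
  also have "\<dots> = (if 2 * t < 1 then 2 * t else 2 * t - 1)"
    using t by (auto simp: frac_eq frac_unique_iff)
  finally show ?thesis using t tn by (auto simp: saw_def t_def[symmetric] abs_less_iff)
qed

lemma ht_double: "d > 0 \<Longrightarrow> ht d (2 * d) = 2" "d > 0 \<Longrightarrow> ht (2 * d) d = 2"
  using ht_scale[of d 1 2] ht_scale[of d 2 1] by (simp_all add: ht_def mult.commute)

definition spike :: "nat \<Rightarrow> nat \<Rightarrow> int" where
  "spike d v = (if v = d then 1 else 0)"

lemma sum_spike:
  fixes h :: "nat \<Rightarrow> 'a::comm_ring_1"
  assumes "finite D" "d \<in> D"
  shows "(\<Sum>c\<in>D. of_int (spike d c) * h c) = h d"
proof -
  have "(\<Sum>c\<in>D. of_int (spike d c) * h c) = (\<Sum>c\<in>D. if d = c then h c else 0)"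
    by (intro sum.cong refl) (simp add: spike_def)
  then show ?thesis using assms by simp
qed

text \<open>Modulo 1 the sawtooth sum of \<open>m\<close> agrees with that of \<open>m'\<close>, and the latter takes its values in
  the open interval from \<open>-1/2\<close> to \<open>1/2\<close>.\<close>

lemma qform_ge_of_cong:
  fixes m m' :: "nat \<Rightarrow> int"
  assumes D: "finite D" "\<forall>c\<in>D. c > 0"
    and slope: "(\<Sum>c\<in>D. m c * int c) = (\<Sum>c\<in>D. m' c * int c)"
    and parity: "even ((\<Sum>c\<in>D. m c) - (\<Sum>c\<in>D. m' c))"
    and M: "M > 0" "\<forall>c\<in>D. c dvd M"
    and small: "\<And>j. \<bar>\<Sum>c\<in>D. m' c * saw (real c * midpoint M j)\<bar> < 1/2"
  shows "qform {} D m' \<le> qform {} D m"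
    "qform {} D m = qform {} D m' \<Longrightarrow> c \<in> D \<Longrightarrow> m c = m' c"
proof -
  define f where "f = (\<lambda>(m :: nat \<Rightarrow> int) j. \<Sum>c\<in>D. m c * saw (real c * midpoint M j))"
  define g where "g = (\<lambda>c. m c - m' c)"
  have fg: "f m j = f g j + f m' j" for j
    by (simp add: f_def g_def left_diff_distrib sum_subtractf)
  have fgZ: "\<exists>k::int. f g j = of_int k" for j
  proof -
    have s: "(\<Sum>c\<in>D. g c * int c) = 0"
      using slope by (simp add: g_def left_diff_distrib sum_subtractf)
    have "even (\<Sum>c\<in>D. g c)" using parity by (simp add: g_def sum_subtractf)
    then obtain e where "(\<Sum>c\<in>D. g c) = 2 * e" by (auto elim: evenE)
    then show ?thesis
      unfolding f_def saw_combination_cong s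
      by (intro exI[of _ "e + (\<Sum>c\<in>D. g c * \<lfloor>real c * midpoint M j\<rfloor>)"]) simp
  qed
  have sq: "(\<Sum>j<M. (f m j)\<^sup>2) = real M / 12 * (qform {} D m - (of_int (\<Sum>c\<in>D. m c * int c))\<^sup>2 / (real M)\<^sup>2)"
    for m :: "nat \<Rightarrow> int"
    unfolding f_def using D M by (subst sum_sawtooth_square) auto
  have pt: "(f m' j)\<^sup>2 \<le> (f m j)\<^sup>2" "(f m j)\<^sup>2 = (f m' j)\<^sup>2 \<Longrightarrow> f g j = 0" for j
  proof -
    obtain k where k: "f g j = of_int k" using fgZ by blast
    have "\<bar>f m' j\<bar> < 1/2" using small[of j] by (simp add: f_def)
    from int_square_add_ge[OF this, of k]
    show "(f m' j)\<^sup>2 \<le> (f m j)\<^sup>2" "(f m j)\<^sup>2 = (f m' j)\<^sup>2 \<Longrightarrow> f g j = 0"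
      using k fg[of j] by auto
  qed
  \<comment> \<open>The slopes agree, so the correction terms of the two discrete means
    cancel.\<close>
  have diff: "(\<Sum>j<M. (f m j)\<^sup>2 - (f m' j)\<^sup>2) = real M / 12 * (qform {} D m - qform {} D m')"
    unfolding sum_subtractf sq slope by (simp add: algebra_simps)
  have "0 \<le> (\<Sum>j<M. (f m j)\<^sup>2 - (f m' j)\<^sup>2)"
    using pt by (intro sum_nonneg) (simp add: diff_ge_0_iff_ge)
  then show "qform {} D m' \<le> qform {} D m"
    unfolding diff using M(1) by (simp add: zero_le_mult_iff)
  assume eq: "qform {} D m = qform {} D m'" and c: "c \<in> D"
  have "(f m j)\<^sup>2 - (f m' j)\<^sup>2 = 0" if "j < M" for j
  proof -
    have "(\<Sum>j<M. (f m j)\<^sup>2 - (f m' j)\<^sup>2) = 0" unfolding diff eq by simp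
    then have "\<forall>j\<in>{..<M}. (f m j)\<^sup>2 - (f m' j)\<^sup>2 = 0"
      by (subst (asm) sum_nonneg_eq_0_iff) (auto simp: pt(1))
    then show ?thesis using that by simp
  qed
  \<comment> \<open>In the case of equality the sawtooth sum of \<open>g = m - m'\<close> vanishes
    at all midpoints. Its slope is 0, so its form vanishes too, and definiteness gives
    \<open>g = 0\<close> on \<open>D\<close>.\<close>
  then have "f g j = 0" if "j < M" for j using pt(2)[of j] that by simp
  then have "(\<Sum>j<M. (f g j)\<^sup>2) = 0" by simp
  moreover have "(\<Sum>c\<in>D. g c * int c) = 0"
    using slope by (simp add: g_def left_diff_distrib sum_subtractf)
  ultimately have "qform {} D g = 0" using sq[of g] M(1) by simp
  then have "real_of_int (g c) = 0" using qform_definite[OF D] c by blast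
  then show "m c = m' c" by (simp add: g_def)
qed

lemma qform_spike:
  assumes "finite D" "d \<in> D" "d > 0" "s\<^sup>2 = 1"
  shows "qform {} D (\<lambda>v. of_int (s * spike d v)) = 1"
proof -
  have "qform {} D (\<lambda>v. of_int (s * spike d v)) = qform {} {d} (\<lambda>v. of_int (s * spike d v))"
    using assms by (intro qform_superset) (auto simp: spike_def)
  also have "\<dots> = of_int (s\<^sup>2)"
    using assms(3) by (simp add: qform_def spike_def kern_empty ht_self power2_eq_square)
  finally show ?thesis using assms by simp
qed

text \<open>The heights give 1 + 1 - 2/2 = 1, as \<open>ht d (2 * d) = 2\<close>.\<close>

lemma qform_spike_pair:
  assumes "finite D" "d \<in> D" "2 * d \<in> D" "d > 0" "s\<^sup>2 = 1"
  shows "qform {} D (\<lambda>v. of_int (s * (spike (2 * d) v - spike d v))) = 1"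
proof -
  have "qform {} D (\<lambda>v. of_int (s * (spike (2 * d) v - spike d v))) =
      qform {} {d, 2 * d} (\<lambda>v. of_int (s * (spike (2 * d) v - spike d v)))"
    using assms by (intro qform_superset) (auto simp: spike_def)
  also have "\<dots> = of_int (s\<^sup>2)"
    using assms(4) by (simp add: qform_def spike_def kern_empty ht_self ht_double power2_eq_square)
  finally show ?thesis using assms by simp
qed

text \<open>The comparison function \<open>m'\<close> is a signed spike at the absolute slope
  \<open>d\<close> if the total multiplicity is odd, and the signed pair
  \<open>spike (2 * d) - spike d\<close> if it is even. Both have slope \<open>s * d\<close>, since
  2d - d = d, and form 1, so \<open>qform_ge_of_cong\<close> applies.\<close>

lemma qform_ge_1:
  fixes m :: "nat \<Rightarrow> int"
  assumes C: "finite C" "\<forall>c\<in>C. c > 0" and slope: "(\<Sum>c\<in>C. m c * int c) \<noteq> 0"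
    and supp: "\<And>v. v \<notin> C \<Longrightarrow> m v = 0"
  shows "qform {} C m \<ge> 1"
    "qform {} C m = 1 \<Longrightarrow> \<exists>d s. d > 0 \<and> s \<in> {1, -1} \<and>
       ((\<forall>v. m v = s * spike d v) \<or> (\<forall>v. m v = s * (spike (2 * d) v - spike d v)))"
proof -
  define \<sigma> where "\<sigma> = (\<Sum>c\<in>C. m c * int c)"
  define d where "d = nat \<bar>\<sigma>\<bar>"
  define s where "s = sgn \<sigma>"
  have d0: "d > 0" using slope by (simp add: d_def \<sigma>_def)
  have s: "s \<in> {1, -1}" "s\<^sup>2 = 1" using slope by (auto simp: s_def \<sigma>_def sgn_if)
  have sd: "s * int d = \<sigma>" by (simp add: s_def d_def sgn_if)
  \<comment> \<open>The support is enlarged so that it carries \<open>m'\<close> as well and so that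
    \<open>M\<close> becomes a multiple of \<open>d\<close> and \<open>2 * d\<close>.\<close>
  define D where "D = C \<union> {d, 2 * d}"
  have D: "finite D" "\<forall>c\<in>D. c > 0" "d \<in> D" "2 * d \<in> D" "C \<subseteq> D" using C d0 by (auto simp: D_def)
  define M where "M = (\<Prod>c\<in>D. c)"
  have M: "M > 0" "\<forall>c\<in>D. c dvd M" using D by (auto simp: M_def intro!: prod_pos dvd_prodI)
  define odd_case where "odd_case \<longleftrightarrow> odd (\<Sum>c\<in>C. m c)"
  define m' where "m' = (if odd_case then (\<lambda>v. s * spike d v) else (\<lambda>v. s * (spike (2 * d) v - spike d v)))"
  have QD: "qform {} D m = qform {} C m"
    using D supp by (intro qform_superset) auto
  have Q': "qform {} D m' = 1"
    using qform_spike[OF D(1,3) d0 s(2)] qform_spike_pair[OF D(1,3,4) d0 s(2)] by (simp add: m'_def)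
  have sumD: "(\<Sum>c\<in>D. m c * h c) = (\<Sum>c\<in>C. m c * h c)" for h :: "nat \<Rightarrow> int"
    using D supp by (intro sum.mono_neutral_right) auto
  have sum1: "(\<Sum>c\<in>D. s * spike d c * h c) = s * h d" for h :: "nat \<Rightarrow> int"
    using sum_spike[OF D(1,3), of h] by (simp add: mult.assoc sum_distrib_left[symmetric])
  have sum2: "(\<Sum>c\<in>D. s * (spike (2 * d) c - spike d c) * h c) = s * (h (2 * d) - h d)" for h :: "nat \<Rightarrow> int"
    using sum_spike[OF D(1,3), of h] sum_spike[OF D(1,4), of h]
    by (simp add: mult.assoc sum_distrib_left[symmetric] left_diff_distrib sum_subtractf)
  have rsum1: "(\<Sum>c\<in>D. of_int (s * spike d c) * h c) = of_int s * h d" for h :: "nat \<Rightarrow> real"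
    using sum_spike[OF D(1,3), of h] by (simp add: mult.assoc sum_distrib_left[symmetric])
  have rsum2: "(\<Sum>c\<in>D. of_int (s * (spike (2 * d) c - spike d c)) * h c) = of_int s * (h (2 * d) - h d)"
    for h :: "nat \<Rightarrow> real"
    using sum_spike[OF D(1,3), of h] sum_spike[OF D(1,4), of h]
    by (simp add: mult.assoc sum_distrib_left[symmetric] left_diff_distrib sum_subtractf)
  have slopeD: "(\<Sum>c\<in>D. m c * int c) = (\<Sum>c\<in>D. m' c * int c)"
    unfolding sumD using sum1[of int] sum2[of int] sd by (simp add: m'_def \<sigma>_def[symmetric])
  have parity: "even ((\<Sum>c\<in>D. m c) - (\<Sum>c\<in>D. m' c))"
    using sumD[of "\<lambda>_. 1"] sum1[of "\<lambda>_. 1"] sum2[of "\<lambda>_. 1"] s(1) by (auto simp: m'_def odd_case_def)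
  have small: "\<bar>\<Sum>c\<in>D. m' c * saw (real c * midpoint M j)\<bar> < 1/2" for j
  proof -
    let ?y = "real d * midpoint M j"
    have n: "?y \<notin> \<int>" "2 * ?y \<notin> \<int>"
      using midpoint_not_int[OF M(1), of d j] midpoint_not_int[OF M(1), of "2 * d" j] M D d0
      by (simp_all add: mult.assoc)
    have "\<bar>saw ?y\<bar> < 1/2" "\<bar>saw (2 * ?y) - saw ?y\<bar> < 1/2"
      using abs_saw_less[OF n(1)] abs_saw_double_less[OF n] .
    moreover have "\<bar>real_of_int s\<bar> = 1" using s(1) by auto
    ultimately show ?thesis
      using rsum1[of "\<lambda>c. saw (real c * midpoint M j)"] rsum2[of "\<lambda>c. saw (real c * midpoint M j)"]
      by (simp add: m'_def abs_mult mult.assoc)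
  qed
  note main = qform_ge_of_cong[OF D(1,2) slopeD parity M small]
  show "qform {} C m \<ge> 1" using main(1) QD Q' by simp
  assume "qform {} C m = 1"
  then have "qform {} D m = qform {} D m'" unfolding QD Q' .
  then have "m v = m' v" if "v \<in> D" for v using that by (rule main(2))
  moreover have "m v = m' v" if "v \<notin> D" for v
    using supp that by (auto simp: m'_def spike_def D_def)
  ultimately have "m v = m' v" for v by blast
  then have "(\<forall>v. m v = s * spike d v) \<or> (\<forall>v. m v = s * (spike (2 * d) v - spike d v))"
    by (cases odd_case) (simp_all only: m'_def if_True if_False, simp_all)
  then show "\<exists>d s. d > 0 \<and> s \<in> {1, -1} \<and>
       ((\<forall>v. m v = s * spike d v) \<or> (\<forall>v. m v = s * (spike (2 * d) v - spike d v)))"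
    using d0 s(1) by blast
qed

text \<open>For slope 0 there is no correction term: the mean of the squares is exactly
  \<open>qform {} C m / 12\<close>, and here it is 1/4.\<close>

lemma qform_eq_3:
  assumes C: "finite C" "\<forall>c\<in>C. c > 0" and slope: "(\<Sum>c\<in>C. m c * real c) = 0"
    and M: "M > 0" "\<forall>c\<in>C. c dvd M"
    and half: "\<And>j. j < M \<Longrightarrow> (\<Sum>c\<in>C. m c * saw (real c * midpoint M j))\<^sup>2 = 1/4"
  shows "qform {} C m = 3"
proof -
  have "(\<Sum>j<M. (\<Sum>c\<in>C. m c * saw (real c * midpoint M j))\<^sup>2) = (\<Sum>j<M. 1/4)"
    using half by (intro sum.cong) auto
  then have "(\<Sum>j<M. (\<Sum>c\<in>C. m c * saw (real c * midpoint M j))\<^sup>2) = real M / 4" by simp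
  moreover have "(\<Sum>j<M. (\<Sum>c\<in>C. m c * saw (real c * midpoint M j))\<^sup>2) = real M / 12 * qform {} C m"
    using C M slope by (subst sum_sawtooth_square) auto
  ultimately show ?thesis using M(1) by simp
qed

text \<open>For slope 0 and odd total multiplicity the sawtooth sum is half an odd integer at every
  midpoint, so its square is at least 1/4.\<close>

lemma qform_ge_3:
  fixes m :: "nat \<Rightarrow> int"
  assumes C: "finite C" "\<forall>c\<in>C. c > 0" and slope: "(\<Sum>c\<in>C. m c * int c) = 0"
    and odd: "odd (\<Sum>c\<in>C. m c)"
  shows "qform {} C m \<ge> 3"
proof -
  define M where "M = (\<Prod>c\<in>C. c)"
  have M: "M > 0" "\<forall>c\<in>C. c dvd M" using C by (auto simp: M_def intro!: prod_pos dvd_prodI)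
  have "(\<Sum>c\<in>C. m c * saw (real c * midpoint M j))\<^sup>2 \<ge> 1/4" for j
  proof -
    define k where "k = (\<Sum>c\<in>C. m c) + 2 * (\<Sum>c\<in>C. m c * \<lfloor>real c * midpoint M j\<rfloor>)"
    have "odd k" using odd by (simp add: k_def)
    then have "\<bar>k\<bar> \<ge> 1" by presburger
    then have "\<bar>real_of_int k\<bar> \<ge> 1" by linarith
    then have "(real_of_int k)\<^sup>2 \<ge> 1" by (metis abs_1 abs_le_square_iff one_power2 abs_one)
    moreover have "(\<Sum>c\<in>C. m c * saw (real c * midpoint M j)) = real_of_int k / 2"
      unfolding saw_combination_cong slope by (simp add: k_def)
    ultimately show ?thesis by (simp only: power_divide) simp
  qed
  then have "(\<Sum>j<M. 1/4) \<le> (\<Sum>j<M. (\<Sum>c\<in>C. m c * saw (real c * midpoint M j))\<^sup>2)"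
    by (intro sum_mono) auto
  also have "\<dots> = real M / 12 * (qform {} C m - (of_int (\<Sum>c\<in>C. m c * int c))\<^sup>2 / (real M)\<^sup>2)"
    using C M by (subst sum_sawtooth_square) auto
  also have "\<dots> = real M / 12 * qform {} C m" by (simp only: slope) simp
  finally show ?thesis using M(1) by simp
qed

section \<open>Landau's criterion and the values of the sawtooth sum\<close>

text \<open>Only the first term of Legendre's formula survives, because no positive number below
  \<open>p ^ 2\<close> is divisible by \<open>p ^ 2\<close>.\<close>

lemma multiplicity_fact_small:
  fixes p n :: nat
  assumes "prime p" "n < p\<^sup>2"
  shows "multiplicity p (fact n :: nat) = n div p"
  using assms(2)
proof (induction n)
  case 0
  then show ?case by simp
next
  case (Suc n)
  have "\<not> p ^ Suc 1 dvd Suc n" using Suc.prems by (auto dest: dvd_imp_le simp: power2_eq_square)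
  then have "multiplicity p (Suc n) = (if p dvd Suc n then 1 else 0)"
    by (auto intro!: multiplicity_eqI not_dvd_imp_multiplicity_0)
  moreover have "multiplicity p (fact (Suc n) :: nat) = multiplicity p (Suc n) + multiplicity p (fact n :: nat)"
    unfolding fact_Suc using assms(1) by (subst prime_elem_multiplicity_mult_distrib) auto
  ultimately show ?case using Suc by (simp add: div_Suc dvd_eq_mod_eq_0)
qed

lemma multiplicity_prod_fact:
  fixes p n :: nat
  assumes "prime p" "\<forall>a\<in>set xs. a * n < p\<^sup>2"
  shows "multiplicity p (\<Prod>a\<leftarrow>xs. fact (a * n) :: nat) = (\<Sum>a\<leftarrow>xs. (a * n) div p)"
  using assms(2)
proof (induction xs)
  case (Cons a xs)
  have "(\<Prod>a\<leftarrow>xs. fact (a * n) :: nat) \<noteq> 0" by (auto simp: prod_list_zero_iff)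
  then have "multiplicity p (\<Prod>a\<leftarrow>a # xs. fact (a * n) :: nat) =
     multiplicity p (fact (a * n) :: nat) + multiplicity p (\<Prod>a\<leftarrow>xs. fact (a * n) :: nat)"
    using assms(1) by (simp add: prime_elem_multiplicity_mult_distrib)
  then show ?case using Cons multiplicity_fact_small[OF assms(1), of "a * n"] by simp
qed simp

lemma factorial_ratio_dvd:
  assumes "factorial_ratio as bs n \<in> \<nat>"
  shows "(\<Prod>b\<leftarrow>bs. fact (b * n) :: nat) dvd (\<Prod>a\<leftarrow>as. fact (a * n))"
proof -
  have of_nat: "(\<Prod>b\<leftarrow>xs. fact (b * n) :: rat) = of_nat (\<Prod>b\<leftarrow>xs. fact (b * n))" for xs
    by (induction xs) auto
  have "(\<Prod>b\<leftarrow>bs. fact (b * n) :: nat) \<noteq> 0" by (auto simp: prod_list_zero_iff)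
  moreover obtain N where "factorial_ratio as bs n = of_nat N" using assms by (auto elim: Nats_cases)
  ultimately have "(of_nat (\<Prod>a\<leftarrow>as. fact (a * n)) :: rat) = of_nat (N * (\<Prod>b\<leftarrow>bs. fact (b * n)))"
    by (simp add: factorial_ratio_def of_nat field_simps)
  then have "(\<Prod>a\<leftarrow>as. fact (a * n) :: nat) = N * (\<Prod>b\<leftarrow>bs. fact (b * n))"
    by (simp only: of_nat_eq_iff)
  then show ?thesis by simp
qed

text \<open>Landau's criterion: approximate \<open>x\<close> from above by \<open>n/p\<close> with a large prime \<open>p\<close> and compare the
  \<open>p\<close>-adic valuations.\<close>

lemma floor_sum_le:
  assumes int: "\<And>n. n > 0 \<Longrightarrow> factorial_ratio as bs n \<in> \<nat>" and x: "0 < x" "x < (1::real)"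
  shows "(\<Sum>b\<leftarrow>bs. \<lfloor>real b * x\<rfloor>) \<le> (\<Sum>a\<leftarrow>as. \<lfloor>real a * x\<rfloor>)"
proof -
  define C where "C = set as \<union> set bs"
  \<comment> \<open>A prime \<open>p\<close> above this bound satisfies
    \<open>c / p < 1 - frac (c * x)\<close>, so rounding \<open>x\<close> up to \<open>n / p\<close>
    does not carry \<open>c * x\<close> to the next integer.\<close>
  define h where "h = (\<lambda>c. nat \<lceil>real c / (1 - frac (real c * x))\<rceil>)"
  obtain p where p: "prime p" "p > (\<Sum>c\<in>C. h c)" using bigger_prime by blast
  have p1: "p > 1" using p prime_gt_1_nat by blast
  define n where "n = nat \<lceil>x * real p\<rceil>"
  have "x * real p > 0" using x p1 by simp
  then have "\<lceil>x * real p\<rceil> > 0" by (simp add: zero_less_ceiling)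
  then have n: "n > 0" "real n \<ge> x * real p" "real n < x * real p + 1" unfolding n_def by linarith+
  have "x * real p < real p" using x p1 by simp
  then have np: "n \<le> p" unfolding n_def by (simp add: ceiling_le_iff)
  have c: "real c / (1 - frac (real c * x)) < real p" if "c \<in> C" for c
  proof -
    have "h c \<le> (\<Sum>c\<in>C. h c)" using that by (intro member_le_sum) (auto simp: C_def)
    then have "h c < p" using p by simp
    then show ?thesis unfolding h_def by linarith
  qed
  have cp: "c < p" if "c \<in> C" for c
  proof -
    have "real c * (1 - frac (real c * x)) \<le> real c * 1"
      using frac_ge_0 by (intro mult_left_mono) auto
    then have "real c \<le> real c / (1 - frac (real c * x))"
      using frac_lt_1[of "real c * x"] by (simp add: field_simps)
    then show ?thesis using c[OF that] by linarith
  qed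
  \<comment> \<open>This reduces Legendre's formula to one term for every factorial in the
    ratio.\<close>
  have small: "c * n < p\<^sup>2" if "c \<in> C" for c
    using cp[OF that] np n(1) p1 by (metis mult_le_mono2 mult_less_mono1 order_less_le_trans order_less_trans power2_eq_square zero_less_one)
  have fl: "int (c * n div p) = \<lfloor>real c * x\<rfloor>" if "c \<in> C" for c
  proof -
    have "\<lfloor>real (c * n) / real p\<rfloor> = \<lfloor>real c * x\<rfloor>"
    proof (rule floor_unique)
      have "of_int \<lfloor>real c * x\<rfloor> \<le> real c * x" by simp
      also have "\<dots> \<le> real (c * n) / real p"
        using n(2) p1 mult_left_mono[OF n(2), of "real c"] by (simp add: field_simps)
      finally show "of_int \<lfloor>real c * x\<rfloor> \<le> real (c * n) / real p" .
      have fr: "1 - frac (real c * x) > 0" using frac_lt_1[of "real c * x"] by simp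
      have "real c / real p < 1 - frac (real c * x)"
        using c[OF that] fr p1 by (simp add: field_simps)
      moreover have "real (c * n) / real p \<le> real c * x + real c / real p"
        using mult_left_mono[OF less_imp_le[OF n(3)], of "real c"] p1 by (simp add: field_simps)
      ultimately show "real (c * n) / real p < of_int \<lfloor>real c * x\<rfloor> + 1"
        by (simp add: frac_def)
    qed
    then show ?thesis by (simp only: floor_divide_of_nat_eq)
  qed
  have "multiplicity p (\<Prod>b\<leftarrow>bs. fact (b * n) :: nat) \<le> multiplicity p (\<Prod>a\<leftarrow>as. fact (a * n) :: nat)"
    using factorial_ratio_dvd[OF int[OF n(1)]] by (intro dvd_imp_multiplicity_le) (auto simp: prod_list_zero_iff)
  then have "(\<Sum>b\<leftarrow>bs. b * n div p) \<le> (\<Sum>a\<leftarrow>as. a * n div p)"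
    using small p(1) by (subst (asm) (1 2) multiplicity_prod_fact) (auto simp: C_def)
  then have "int (\<Sum>b\<leftarrow>bs. b * n div p) \<le> int (\<Sum>a\<leftarrow>as. a * n div p)" by (simp only: of_nat_le_iff)
  moreover have "int (\<Sum>c\<leftarrow>xs. c * n div p) = (\<Sum>c\<leftarrow>xs. \<lfloor>real c * x\<rfloor>)" if "set xs \<subseteq> C" for xs
    using that by (induction xs) (auto simp: fl)
  ultimately show ?thesis by (simp add: C_def)
qed

text \<open>Landau's inequality is used at \<open>x\<close> and at \<open>1 - x\<close>. Away from
  integers the reflection turns floor(cx) into c - 1 - floor(cx), and the denominator has one entry
  more, so the two inequalities bound the difference \<open>k\<close> of the floor sums by 0 from
  below and by 1 from above.\<close>

lemma saw_list_square:
  assumes adm: "admissible as bs" and x: "0 < x" "x < 1"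
    and gen: "\<And>c. c \<in> set as \<union> set bs \<Longrightarrow> real c * x \<notin> \<int>"
  shows "((\<Sum>a\<leftarrow>as. saw (real a * x)) - (\<Sum>b\<leftarrow>bs. saw (real b * x)))\<^sup>2 = 1/4"
proof -
  define F where "F = (\<lambda>xs y. \<Sum>a\<leftarrow>xs. \<lfloor>real a * y\<rfloor>)"
  have int: "\<And>n. n > 0 \<Longrightarrow> factorial_ratio as bs n \<in> \<nat>"
    and len: "length bs = length as + 1" and sum: "sum_list as = sum_list bs"
    using adm by (auto simp: admissible_def)
  have le: "F bs x \<le> F as x" "F bs (1 - x) \<le> F as (1 - x)"
    using floor_sum_le[OF int, of x] floor_sum_le[OF int, of "1 - x"] x by (auto simp: F_def)
  have flip: "F xs (1 - x) = int (sum_list xs) - int (length xs) - F xs x" if "set xs \<subseteq> set as \<union> set bs" for xs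
    using that
  proof (induction xs)
    case (Cons c xs)
    have "real c * x \<notin> \<int>" using gen Cons.prems by auto
    then have "\<lfloor>real c * (1 - x)\<rfloor> = int c - 1 - \<lfloor>real c * x\<rfloor>"
      by (intro floor_unique) (use frac_gt_0[of "real c * x"] in \<open>auto simp: frac_def algebra_simps\<close>, linarith+)
    then show ?case using Cons by (simp add: F_def)
  qed (simp add: F_def)
  have saw: "(\<Sum>a\<leftarrow>xs. saw (real a * x)) = real (length xs) / 2 - real (sum_list xs) * x + of_int (F xs x)" for xs
    by (induction xs) (auto simp: F_def saw_def frac_def algebra_simps)
  define k where "k = F as x - F bs x"
  have "k = 0 \<or> k = 1" using le flip[of as] flip[of bs] len sum by (auto simp: k_def)
  moreover have "(\<Sum>a\<leftarrow>as. saw (real a * x)) - (\<Sum>b\<leftarrow>bs. saw (real b * x)) = of_int k - 1/2"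
    unfolding saw by (simp add: len sum k_def field_simps)
  ultimately show ?thesis by (auto simp: power2_eq_square)
qed

section \<open>Signed multiplicities of a tuple and the bound for its length\<close>

text \<open>Numerator and denominator entries of an admissible tuple are disjoint, so its two
  multisets are the positive and the negative part of this function.\<close>

definition mass :: "nat list \<Rightarrow> nat list \<Rightarrow> nat \<Rightarrow> int" where
  "mass as bs v = int (count (mset as) v) - int (count (mset bs) v)"

lemma sum_mass:
  fixes h :: "nat \<Rightarrow> 'a::comm_ring_1"
  assumes "finite C" "set as \<union> set bs \<subseteq> C"
  shows "(\<Sum>c\<in>C. of_int (mass as bs c) * h c) = (\<Sum>a\<leftarrow>as. h a) - (\<Sum>b\<leftarrow>bs. h b)"
proof -
  have "(\<Sum>c\<in>C. of_nat (count (mset xs) c) * h c) = (\<Sum>a\<leftarrow>xs. h a)" if "set xs \<subseteq> C" for xs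
    using that
  proof (induction xs)
    case (Cons x xs)
    have "(\<Sum>c\<in>C. of_nat (count (mset (x # xs)) c) * h c) =
       (\<Sum>c\<in>C. of_nat (count (mset xs) c) * h c + (if x = c then h c else 0))"
      by (intro sum.cong refl) (auto simp: algebra_simps)
    also have "\<dots> = (\<Sum>a\<leftarrow>x # xs. h a)"
      using Cons assms(1) by (simp add: sum.distrib)
    finally show ?case .
  qed simp
  then show ?thesis using assms(2) by (simp add: mass_def left_diff_distrib sum_subtractf)
qed

lemma admissible_qform:
  assumes "admissible as bs"
  shows "qform {} (set as \<union> set bs) (mass as bs) = 3"
proof -
  define C where "C = set as \<union> set bs"
  define M where "M = (\<Prod>c\<in>C. c)"
  have C: "finite C" "\<forall>c\<in>C. c > 0" using assms by (auto simp: C_def admissible_def)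
  have M: "M > 0" "\<forall>c\<in>C. c dvd M" using C by (auto simp: M_def intro!: prod_pos dvd_prodI)
  have sum_real: "(\<Sum>a\<leftarrow>xs. real a) = real (sum_list xs)" for xs by (induction xs) auto
  show ?thesis unfolding C_def[symmetric]
  proof (rule qform_eq_3[OF C _ M])
    show "(\<Sum>c\<in>C. of_int (mass as bs c) * real c) = 0"
      using assms C(1) by (subst sum_mass) (auto simp: C_def sum_real admissible_def)
    fix j assume j: "j < M"
    have "0 < midpoint M j" "midpoint M j < 1"
      using j by (auto simp: midpoint_def field_simps)
    moreover have "real c * midpoint M j \<notin> \<int>" if "c \<in> C" for c
      using midpoint_not_int[OF M(1)] M C that by blast
    ultimately show "(\<Sum>c\<in>C. of_int (mass as bs c) * saw (real c * midpoint M j))\<^sup>2 = 1/4"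
      using saw_list_square[OF assms] C(1) by (subst sum_mass) (auto simp: C_def)
  qed
qed

lemma admissible_sum_abs_mass:
  assumes "admissible as bs"
  shows "(\<Sum>c\<in>set as \<union> set bs. \<bar>mass as bs c\<bar>) = int (length as + length bs)"
proof -
  have dis: "set as \<inter> set bs = {}" using assms by (auto simp: admissible_def)
  have "\<bar>mass as bs c\<bar> = int (count (mset as) c) + int (count (mset bs) c)" for c
  proof -
    have "count (mset as) c = 0 \<or> count (mset bs) c = 0"
      using dis by (auto simp: count_mset_0_iff)
    then show ?thesis unfolding mass_def by linarith
  qed
  then have "(\<Sum>c\<in>set as \<union> set bs. \<bar>mass as bs c\<bar>) =
     (\<Sum>c\<in>set as \<union> set bs. int (count (mset as) c)) + (\<Sum>c\<in>set as \<union> set bs. int (count (mset bs) c))"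
    by (simp add: sum.distrib)
  also have "(\<Sum>c\<in>set as \<union> set bs. int (count (mset as) c)) = int (length as)"
    using sum_mass[of "set as \<union> set bs" as "[]" "\<lambda>_. 1::int"] by (simp add: mass_def sum_list_triv)
  also have "(\<Sum>c\<in>set as \<union> set bs. int (count (mset bs) c)) = int (length bs)"
    using sum_mass[of "set as \<union> set bs" bs "[]" "\<lambda>_. 1::int"] by (simp add: mass_def sum_list_triv)
  finally show ?thesis by simp
qed

text \<open>The masses are integers, so their sum of squares is at least the number \<open>n\<close>
  of entries. Sieving by the primes up to \<open>P\<close> gives n/2 <= 3G, while
  \<open>G ^ 3\<close> grows only quadratically in \<open>n\<close>.\<close>

lemma admissible_length_bound:
  assumes adm: "admissible as bs"
  shows "length as \<le> 1000000"
proof -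
  define C where "C = set as \<union> set bs"
  define n where "n = length as + length bs"
  \<comment> \<open>The form \<open>6 * n + 7\<close> matches \<open>prod_primes_cube_le\<close> at
    \<open>t = n\<close>, and \<open>P >= 2 * n\<close> keeps the error below n/2.\<close>
  define P where "P = 6 * n + 7"
  let ?R = "{p::nat. prime p \<and> p \<le> P}"
  define m where "m = (\<lambda>c. real_of_int (mass as bs c))"
  define G where "G = (\<Prod>p\<in>?R. (real p + 1) / (real p - 1))"
  have C: "finite C" "\<forall>c\<in>C. c > 0" using adm by (auto simp: C_def admissible_def)
  have abs: "(\<Sum>c\<in>C. \<bar>m c\<bar>) = real n"
    using arg_cong[OF admissible_sum_abs_mass[OF adm], of real_of_int] by (simp add: C_def m_def n_def)
  have "(\<Sum>c\<in>C. \<bar>m c\<bar>) \<le> (\<Sum>c\<in>C. (m c)\<^sup>2)"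
  proof (intro sum_mono)
    fix c
    have "\<bar>k\<bar> \<le> k\<^sup>2" for k :: int
    proof (cases "k = 0")
      case False
      then have "\<bar>k\<bar> * 1 \<le> \<bar>k\<bar> * \<bar>k\<bar>" by (intro mult_left_mono) auto
      then show ?thesis by (simp add: power2_eq_square)
    qed simp
    then have "real_of_int \<bar>mass as bs c\<bar> \<le> real_of_int ((mass as bs c)\<^sup>2)" by (simp only: of_int_le_iff)
    then show "\<bar>m c\<bar> \<le> (m c)\<^sup>2" by (simp add: m_def)
  qed
  then have "real n - (real n)\<^sup>2 / real P \<le> (\<Sum>c\<in>C. (m c)\<^sup>2) - (\<Sum>c\<in>C. \<bar>m c\<bar>)\<^sup>2 / real P"
    using abs by simp
  also have "\<dots> \<le> qform ?R C m" using C by (intro qform_primes_ge) (auto simp: P_def)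
  also have "\<dots> \<le> G * qform {} C m" unfolding G_def using C by (intro qform_le_prod) auto
  also have "\<dots> = 3 * G" using admissible_qform[OF adm] by (simp add: C_def m_def)
  finally have "real n - (real n)\<^sup>2 / real P \<le> 3 * G" .
  moreover have "(real n)\<^sup>2 / real P \<le> real n / 2"
    by (simp add: P_def field_simps power2_eq_square)
  ultimately have "real n \<le> 6 * G" by simp
  then have "real n ^ 3 \<le> (6 * G) ^ 3" by (intro power_mono) auto
  also have "\<dots> = 216 * G ^ 3" by (simp add: power_mult_distrib)
  also have "G ^ 3 \<le> 108 * (3 * real n + 4)\<^sup>2" unfolding G_def P_def by (rule prod_primes_cube_le)
  finally have le: "real n ^ 3 \<le> 23328 * (3 * real n + 4)\<^sup>2" by simp
  have "real n \<le> 1000000"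
  proof (rule ccontr)
    assume "\<not> real n \<le> 1000000"
    then have big: "real n > 1000000" by simp
    \<comment> \<open>Here 23328 = 216 * 108, and 23328 * 4^2 is still less than 1000000.\<close>
    have "23328 * (3 * real n + 4)\<^sup>2 \<le> 23328 * (4 * real n)\<^sup>2"
      using big by (intro mult_left_mono power_mono) auto
    also have "\<dots> < 1000000 * (real n)\<^sup>2" using big by (simp add: power_mult_distrib)
    also have "\<dots> \<le> real n * (real n)\<^sup>2" using big by (intro mult_right_mono) auto
    finally show False using le by (simp add: power3_eq_cube power2_eq_square)
  qed
  then show ?thesis by (simp add: n_def)
qed

section \<open>Clusters of proportional entries\<close>

text \<open>Both alternatives pass to subsets, so the functions can be treated one by one. A finite
  image has an infinite fiber; for an infinite image, one preimage per value is kept.\<close>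

lemma infinite_subset_const_or_inj:
  assumes "finite H" "infinite S"
  shows "\<exists>T\<subseteq>S. infinite T \<and> (\<forall>h\<in>H. (\<exists>v. \<forall>t\<in>T. h t = v) \<or> inj_on h T)"
  using assms(1)
proof (induction H)
  case empty
  then show ?case using assms(2) by blast
next
  case (insert h H)
  then obtain T where T: "T \<subseteq> S" "infinite T" "\<forall>h\<in>H. (\<exists>v. \<forall>t\<in>T. h t = v) \<or> inj_on h T" by blast
  have "\<exists>U\<subseteq>T. infinite U \<and> ((\<exists>v. \<forall>t\<in>U. h t = v) \<or> inj_on h U)"
  proof (cases "finite (h ` T)")
    case True
    then obtain t where t: "t \<in> T" "infinite {u\<in>T. h u = h t}"
      using pigeonhole_infinite[OF T(2)] by blast
    then show ?thesis by (intro exI[of _ "{u\<in>T. h u = h t}"]) auto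
  next
    case False
    define U where "U = inv_into T h ` (h ` T)"
    have "inj_on h U" unfolding U_def by (auto simp: inj_on_def f_inv_into_f)
    moreover have "infinite U"
      using False inj_on_inv_into[of "h ` T" h T] unfolding U_def by (simp add: finite_image_iff)
    moreover have "U \<subseteq> T" unfolding U_def by (auto intro: inv_into_into)
    ultimately show ?thesis by blast
  qed
  then obtain U where U: "U \<subseteq> T" "infinite U" "(\<exists>v. \<forall>t\<in>U. h t = v) \<or> inj_on h U" by blast
  have "(\<exists>v. \<forall>t\<in>U. g t = v) \<or> inj_on g U" if "g \<in> H" for g
    using T(3) that U(1) by (meson inj_on_subset subsetD)
  then show ?case using U T(1) by (intro exI[of _ U]) auto
qed

text \<open>The push-forward of the signs \<open>e\<close> along \<open>c\<close>. Distinct indices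
  may carry equal entries, whereas \<open>qform\<close> works with multiplicities of values.\<close>

definition fiber_sum :: "nat set \<Rightarrow> (nat \<Rightarrow> int) \<Rightarrow> (nat \<Rightarrow> nat) \<Rightarrow> nat \<Rightarrow> int" where
  "fiber_sum J e c v = (\<Sum>i\<in>J. e i * spike (c i) v)"

lemma sum_fiber_sum:
  fixes h :: "nat \<Rightarrow> 'a::comm_ring_1"
  assumes "finite D" "c ` J \<subseteq> D"
  shows "(\<Sum>v\<in>D. of_int (fiber_sum J e c v) * h v) = (\<Sum>i\<in>J. of_int (e i) * h (c i))"
proof -
  have "(\<Sum>v\<in>D. of_int (fiber_sum J e c v) * h v) =
      (\<Sum>i\<in>J. \<Sum>v\<in>D. of_int (e i) * (of_int (spike (c i) v) * h v))"
    unfolding fiber_sum_def of_int_sum sum_distrib_right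
    by (subst sum.swap) (simp add: mult.assoc)
  also have "\<dots> = (\<Sum>i\<in>J. of_int (e i) * h (c i))"
    using assms by (intro sum.cong refl) (auto simp: sum_distrib_left[symmetric] sum_spike)
  finally show ?thesis .
qed

lemma qform_fiber_sum:
  assumes "finite D" "c ` J \<subseteq> D"
  shows "qform {} D (fiber_sum J e c) =
    (\<Sum>i\<in>J. \<Sum>j\<in>J. of_int (e i) * of_int (e j) / real (ht (c i) (c j)))"
proof -
  have "qform {} D (fiber_sum J e c) = (\<Sum>a\<in>D. of_int (fiber_sum J e c a) *
      (\<Sum>b\<in>D. of_int (fiber_sum J e c b) * (1 / real (ht a b))))"
    by (simp add: qform_def kern_empty sum_distrib_left mult.assoc)
  also have "\<dots> = (\<Sum>i\<in>J. of_int (e i) * (\<Sum>j\<in>J. of_int (e j) * (1 / real (ht (c i) (c j)))))"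
    by (simp only: sum_fiber_sum[OF assms])
  finally show ?thesis by (simp add: sum_distrib_left)
qed

text \<open>All indices with the value \<open>c i\<close> carry the same sign, so nothing
  cancels.\<close>

lemma fiber_sum_nonzero:
  assumes "finite J" "i \<in> J" "e i \<noteq> 0" "\<And>j. j \<in> J \<Longrightarrow> c j = c i \<Longrightarrow> e j = e i"
  shows "fiber_sum J e c (c i) \<noteq> 0"
proof -
  have "fiber_sum J e c (c i) = (\<Sum>j\<in>J. if c j = c i then e i else 0)"
    unfolding fiber_sum_def using assms(4) by (intro sum.cong refl) (auto simp: spike_def)
  also have "\<dots> = int (card {j\<in>J. c j = c i}) * e i"
    using assms(1) by (simp add: sum.If_cases Int_def)
  finally have "fiber_sum J e c (c i) = int (card {j\<in>J. c j = c i}) * e i" .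
  moreover have "card {j\<in>J. c j = c i} \<noteq> 0" using assms(1,2) by (auto simp: card_eq_0_iff)
  ultimately show ?thesis using assms(3) by simp
qed

text \<open>A bound on the height bounds the reduced numerator and denominator, leaving finitely
  many ratios, and the ratio determines \<open>t\<close>.\<close>

lemma finite_bounded_ht:
  assumes "inj_on (\<lambda>t. real (x t) / real (y t)) S" "\<And>t. t \<in> S \<Longrightarrow> x t > 0 \<and> y t > 0"
  shows "finite {t\<in>S. ht (x t) (y t) \<le> N}"
proof (rule inj_on_finite)
  show "inj_on (\<lambda>t. real (x t) / real (y t)) {t\<in>S. ht (x t) (y t) \<le> N}"
    using assms(1) by (rule inj_on_subset) auto
  show "(\<lambda>t. real (x t) / real (y t)) ` {t\<in>S. ht (x t) (y t) \<le> N} \<subseteq>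
      (\<lambda>(a, b). real a / real b) ` ({..N} \<times> {..N})"
  proof
    fix r assume "r \<in> (\<lambda>t. real (x t) / real (y t)) ` {t\<in>S. ht (x t) (y t) \<le> N}"
    then obtain t where t: "t \<in> S" "ht (x t) (y t) \<le> N" "r = real (x t) / real (y t)" by auto
    have pos: "x t > 0" "y t > 0" using assms(2) t by auto
    show "r \<in> (\<lambda>(a, b). real a / real b) ` ({..N} \<times> {..N})"
    proof (cases rule: gcd_cofactor_coprime[OF pos])
      case (1 g u v)
      have "r = real u / real v" using t(3) 1(1,2,4) by simp
      moreover have "u \<le> u * v" "v \<le> u * v" using 1(5,6) by auto
      then have "u \<le> N" "v \<le> N" using t(2) unfolding 1(9) by linarith+
      ultimately show ?thesis by (intro image_eqI[of _ _ "(u, v)"]) auto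
    qed
  qed
qed auto

text \<open>The case of equality in \<open>qform_ge_1\<close>: up to sign, the sawtooth saw(dx) or
  the difference saw(2dx) - saw(dx).\<close>

definition atom :: "(nat \<Rightarrow> int) \<Rightarrow> bool" where
  "atom m \<longleftrightarrow> (\<exists>d s. d > 0 \<and> s \<in> {1, -1} \<and>
     ((\<forall>v. m v = s * spike d v) \<or> (\<forall>v. m v = s * (spike (2 * d) v - spike d v))))"

section \<open>Infinite families in which each ratio of entries is constant or injective\<close>

text \<open>The tuples are \<open>c t\<close> for \<open>t\<close> in \<open>S\<close>, with a
  common sign pattern \<open>e\<close> marking numerator and denominator. The assumption
  \<open>norm\<close> says that the quadratic form equals 3, written over indices.\<close>

locale ratio_family =
  fixes S :: "'t set" and n :: nat and c :: "'t \<Rightarrow> nat \<Rightarrow> nat" and e :: "nat \<Rightarrow> int"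
  assumes infinite: "infinite S"
    and pos: "t \<in> S \<Longrightarrow> i < n \<Longrightarrow> c t i > 0"
    and norm: "t \<in> S \<Longrightarrow>
      (\<Sum>i<n. \<Sum>j<n. of_int (e i) * of_int (e j) / real (ht (c t i) (c t j))) = 3"
    and slope: "t \<in> S \<Longrightarrow> (\<Sum>i<n. e i * int (c t i)) = 0"
    and sign: "i < n \<Longrightarrow> e i \<in> {1, -1}"
    and same_sign: "t \<in> S \<Longrightarrow> i < n \<Longrightarrow> j < n \<Longrightarrow> c t i = c t j \<Longrightarrow> e i = e j"
    and odd: "odd n"
    and const_or_inj: "i < n \<Longrightarrow> j < n \<Longrightarrow>
      (\<exists>q. \<forall>t\<in>S. real (c t i) / real (c t j) = q) \<or> inj_on (\<lambda>t. real (c t i) / real (c t j)) S"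
begin

definition rel :: "nat \<Rightarrow> nat \<Rightarrow> bool" where
  "rel i j \<longleftrightarrow> (\<forall>t\<in>S. \<forall>u\<in>S. c t i * c u j = c u i * c t j)"

lemma not_rel_inj:
  assumes "i < n" "j < n" "\<not> rel i j"
  shows "inj_on (\<lambda>t. real (c t i) / real (c t j)) S"
proof -
  have False if q: "\<forall>t\<in>S. real (c t i) / real (c t j) = q" for q
  proof -
    have "c t i * c u j = c u i * c t j" if "t \<in> S" "u \<in> S" for t u
    proof -
      have "real (c t i) / real (c t j) = real (c u i) / real (c u j)" using q that by simp
      then have "real (c t i * c u j) = real (c u i * c t j)"
        using pos[OF that(1) assms(2)] pos[OF that(2) assms(2)] by (simp add: field_simps)
      then show ?thesis by (simp only: of_nat_eq_iff)
    qed
    then show False using assms(3) by (simp add: rel_def)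
  qed
  then show ?thesis using const_or_inj[OF assms(1,2)] by blast
qed

lemma rel_refl: "rel i i"
  by (simp add: rel_def mult.commute)

lemma rel_sym: "rel i j \<Longrightarrow> rel j i"
  unfolding rel_def by (metis mult.commute)

lemma rel_trans:
  assumes "rel i j" "rel j k" "j < n"
  shows "rel i k"
  unfolding rel_def
proof (intro ballI)
  fix t u assume tu: "t \<in> S" "u \<in> S"
  have "(c t i * c u k) * (c t j * c u j) = (c t i * c u j) * (c t j * c u k)" by simp
  also have "\<dots> = (c u i * c t j) * (c u j * c t k)"
    using assms tu unfolding rel_def by simp
  also have "\<dots> = (c u i * c t k) * (c t j * c u j)" by simp
  finally show "c t i * c u k = c u i * c t k"
    using pos[OF tu(1) assms(3)] pos[OF tu(2) assms(3)] by simp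
qed

definition cluster :: "nat \<Rightarrow> nat set" where
  "cluster i = {j. j < n \<and> rel i j}"

definition clusters :: "nat set set" where
  "clusters = cluster ` {..<n}"

lemma cluster_subset: "J \<in> clusters \<Longrightarrow> J \<subseteq> {..<n}"
  by (auto simp: clusters_def cluster_def)

lemma finite_clusters: "finite clusters" "J \<in> clusters \<Longrightarrow> finite J"
  using cluster_subset by (auto simp: clusters_def intro: finite_subset)

lemma cluster_nonempty: "J \<in> clusters \<Longrightarrow> J \<noteq> {}"
  using rel_refl by (auto simp: clusters_def cluster_def)

lemma cluster_eq:
  assumes "J \<in> clusters" "i \<in> J"
  shows "cluster i = J"
proof -
  obtain k where k: "k < n" "J = cluster k" using assms by (auto simp: clusters_def)
  then have "rel k i" "i < n" using assms by (auto simp: cluster_def)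
  then show ?thesis using k rel_trans rel_sym unfolding cluster_def by blast
qed

lemma sum_clusters: "(\<Sum>i<n. h i) = (\<Sum>J\<in>clusters. \<Sum>i\<in>J. h i)"
proof -
  have "(\<Sum>i<n. h i) = (\<Sum>J\<in>cluster ` {..<n}. \<Sum>i\<in>{i\<in>{..<n}. cluster i = J}. h i)"
    by (rule sum.image_gen) simp
  also have "\<dots> = (\<Sum>J\<in>clusters. \<Sum>i\<in>J. h i)"
    unfolding clusters_def[symmetric]
  proof (rule sum.cong[OF refl])
    fix J assume J: "J \<in> clusters"
    have "{i\<in>{..<n}. cluster i = J} = J"
      using cluster_eq[OF J] cluster_subset[OF J] rel_refl by (auto simp: cluster_def)
    then show "(\<Sum>i\<in>{i\<in>{..<n}. cluster i = J}. h i) = (\<Sum>i\<in>J. h i)" by simp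
  qed
  finally show ?thesis .
qed

text \<open>For each unrelated pair only finitely many tuples have height at most \<open>N\<close>,
  by \<open>finite_bounded_ht\<close>; there are finitely many pairs, but \<open>S\<close> is
  infinite.\<close>

lemma large_ht:
  "\<exists>t\<in>S. \<forall>i<n. \<forall>j<n. \<not> rel i j \<longrightarrow> ht (c t i) (c t j) > N"
proof -
  define B where "B = (\<Union>(i, j)\<in>{(i, j). i < n \<and> j < n \<and> \<not> rel i j}. {t\<in>S. ht (c t i) (c t j) \<le> N})"
  have "{(i, j). i < n \<and> j < n \<and> \<not> rel i j} \<subseteq> {..<n} \<times> {..<n}" by auto
  then have "finite {(i, j). i < n \<and> j < n \<and> \<not> rel i j}" by (rule finite_subset) simp
  then have "finite B"
    unfolding B_def using not_rel_inj pos by (auto intro!: finite_bounded_ht)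
  then obtain t where "t \<in> S" "t \<notin> B" using infinite by (meson finite_subset subsetI)
  then show ?thesis by (intro bexI[of _ t]) (auto simp: B_def not_le)
qed

abbreviation cluster_form :: "'t \<Rightarrow> nat set \<Rightarrow> real" where
  "cluster_form t J \<equiv> qform {} (c t ` J) (fiber_sum J e (c t))"

lemma cluster_form_eq:
  assumes "J \<in> clusters"
  shows "cluster_form t J =
    (\<Sum>i\<in>J. \<Sum>j\<in>J. of_int (e i) * of_int (e j) / real (ht (c t i) (c t j)))"
  by (rule qform_fiber_sum[OF _ order_refl]) (simp add: finite_clusters(2)[OF assms])

lemma abs_e: "i < n \<Longrightarrow> \<bar>real_of_int (e i)\<bar> = 1"
  using sign[of i] by auto

text \<open>The cross terms tend to 0 along \<open>S\<close> while the sum over the clusters is constant.\<close>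

lemma sum_cluster_forms:
  assumes "t \<in> S"
  shows "(\<Sum>J\<in>clusters. cluster_form t J) = 3"
proof -
  define X where "X = (\<lambda>t. \<Sum>J\<in>clusters. cluster_form t J)"
  define w where "w = (\<lambda>t i j. of_int (e i) * of_int (e j) / real (ht (c t i) (c t j)))"
  have X: "X t = (\<Sum>i<n. \<Sum>j<n. if rel i j then w t i j else 0)" for t
  proof -
    have "X t = (\<Sum>J\<in>clusters. \<Sum>i\<in>J. \<Sum>j<n. if rel i j then w t i j else 0)"
      unfolding X_def
    proof (intro sum.cong refl)
      fix J assume J: "J \<in> clusters"
      have "(\<Sum>j\<in>J. w t i j) = (\<Sum>j<n. if rel i j then w t i j else 0)" if "i \<in> J" for i
      proof -
        have "J = {..<n} \<inter> {j. rel i j}" using cluster_eq[OF J that] by (auto simp: cluster_def)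
        then show ?thesis by (simp add: sum.If_cases)
      qed
      then show "cluster_form t J = (\<Sum>i\<in>J. \<Sum>j<n. if rel i j then w t i j else 0)"
        unfolding cluster_form_eq[OF J] by (intro sum.cong[OF refl[of J]]) (simp add: w_def)
    qed
    then show ?thesis by (simp add: sum_clusters)
  qed
  \<comment> \<open>Ratios inside a cluster, and hence their heights, are the same for all
    tuples.\<close>
  have const: "X u = X t" if "u \<in> S" for u
    unfolding X
  proof (intro sum.cong refl)
    fix i j assume "i \<in> {..<n}" "j \<in> {..<n}"
    then have ij: "i < n" "j < n" by auto
    have "ht (c u i) (c u j) = ht (c t i) (c t j)" if "rel i j"
      using that \<open>u \<in> S\<close> assms pos ij unfolding rel_def by (intro ht_cong_ratio) auto
    then show "(if rel i j then w u i j else 0) = (if rel i j then w t i j else 0)"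
      by (simp add: w_def)
  qed
  have "\<bar>3 - X t\<bar> \<le> (real n)\<^sup>2 / real N" if "N > 0" for N :: nat
  proof -
    obtain u where u: "u \<in> S" "\<And>i j. i < n \<Longrightarrow> j < n \<Longrightarrow> \<not> rel i j \<Longrightarrow> ht (c u i) (c u j) > N"
      using large_ht[of N] by blast
    have "3 - X u = (\<Sum>i<n. \<Sum>j<n. w u i j) - (\<Sum>i<n. \<Sum>j<n. if rel i j then w u i j else 0)"
      using norm[OF u(1)] by (simp add: X w_def)
    also have "\<dots> = (\<Sum>i<n. \<Sum>j<n. if rel i j then 0 else w u i j)"
      unfolding sum_subtractf[symmetric] by (intro sum.cong refl) auto
    finally have "\<bar>3 - X u\<bar> = \<bar>\<Sum>i<n. \<Sum>j<n. if rel i j then 0 else w u i j\<bar>" by simp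
    also have "\<dots> \<le> (\<Sum>i<n. \<Sum>j<n. \<bar>if rel i j then 0 else w u i j\<bar>)"
      by (intro order_trans[OF sum_abs] sum_mono sum_abs)
    also have "\<dots> \<le> (\<Sum>i<n. \<Sum>j<n. 1 / real N)"
    proof (intro sum_mono)
      fix i j assume "i \<in> {..<n}" "j \<in> {..<n}"
      then have ij: "i < n" "j < n" by auto
      show "\<bar>if rel i j then 0 else w u i j\<bar> \<le> 1 / real N"
      proof (cases "rel i j")
        case False
        then have "real N \<le> real (ht (c u i) (c u j))" using u(2)[OF ij] by simp
        then show ?thesis using False that by (simp add: w_def abs_mult abs_e ij frac_le)
      qed simp
    qed
    also have "\<dots> = (real n)\<^sup>2 / real N" by (simp add: power2_eq_square)
    finally show ?thesis using const[OF u(1)] by simp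
  qed
  then have bound: "\<bar>3 - X t\<bar> * real N \<le> (real n)\<^sup>2" if "N > 0" for N :: nat
    using that by (simp add: field_simps)
  have "\<bar>3 - X t\<bar> = 0"
  proof (rule ccontr)
    assume "\<bar>3 - X t\<bar> \<noteq> 0"
    then have p: "\<bar>3 - X t\<bar> > 0" by simp
    obtain N :: nat where N: "real N > (real n)\<^sup>2 / \<bar>3 - X t\<bar>" using reals_Archimedean2 by blast
    moreover have "(real n)\<^sup>2 / \<bar>3 - X t\<bar> \<ge> 0" by simp
    ultimately have "N > 0" by (cases N) auto
    then show False using bound[of N] N p by (simp add: field_simps)
  qed
  then show ?thesis by (simp add: X_def)
qed

section \<open>Slopes of clusters and lower bounds for their forms\<close>

definition cslope :: "'t \<Rightarrow> nat set \<Rightarrow> int" where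
  "cslope t J = (\<Sum>i\<in>J. e i * int (c t i))"

text \<open>Passing from one tuple to another scales all entries of a cluster by the same factor,
  hence also its slope.\<close>

lemma cslope_proportional:
  assumes "J \<in> clusters" "i \<in> J" "t \<in> S" "u \<in> S"
  shows "cslope t J * int (c u i) = cslope u J * int (c t i)"
  unfolding cslope_def sum_distrib_right
proof (intro sum.cong refl)
  fix j assume "j \<in> J"
  then have "rel i j" using cluster_eq[OF assms(1,2)] by (auto simp: cluster_def)
  then have "c t j * c u i = c u j * c t i" using assms(3,4) unfolding rel_def by (metis mult.commute)
  then have "int (c t j) * int (c u i) = int (c u j) * int (c t i)" by (metis of_nat_mult)
  then show "e j * int (c t j) * int (c u i) = e j * int (c u j) * int (c t i)" by simp
qed

lemma cslope_zero_iff: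
  assumes "J \<in> clusters" "t \<in> S" "u \<in> S"
  shows "cslope t J = 0 \<longleftrightarrow> cslope u J = 0"
proof -
  obtain i where i: "i \<in> J" using cluster_nonempty[OF assms(1)] by blast
  then have "c t i > 0" "c u i > 0" using pos assms cluster_subset by auto
  then show ?thesis using cslope_proportional[OF assms(1) i assms(2,3)] by auto
qed

lemma cluster_props:
  assumes "J \<in> clusters" "t \<in> S"
  shows "finite (c t ` J)" "\<forall>v\<in>c t ` J. v > 0"
    "(\<Sum>v\<in>c t ` J. fiber_sum J e (c t) v * int v) = cslope t J"
    "(\<Sum>v\<in>c t ` J. fiber_sum J e (c t) v) = (\<Sum>i\<in>J. e i)"
    "\<And>v. v \<notin> c t ` J \<Longrightarrow> fiber_sum J e (c t) v = 0"
proof -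
  show fin: "finite (c t ` J)" using finite_clusters(2)[OF assms(1)] by simp
  show "\<forall>v\<in>c t ` J. v > 0" using pos assms cluster_subset by blast
  show "(\<Sum>v\<in>c t ` J. fiber_sum J e (c t) v * int v) = cslope t J"
    using sum_fiber_sum[OF fin order_refl, of e int] by (simp add: cslope_def)
  show "(\<Sum>v\<in>c t ` J. fiber_sum J e (c t) v) = (\<Sum>i\<in>J. e i)"
    using sum_fiber_sum[OF fin order_refl, of e "\<lambda>_. 1::int"] by simp
  show "\<And>v. v \<notin> c t ` J \<Longrightarrow> fiber_sum J e (c t) v = 0"
    unfolding fiber_sum_def by (intro sum.neutral) (auto simp: spike_def)
qed

text \<open>Equal entries have equal signs, so the signed multiplicities of a cluster do not all
  cancel, and the form is definite.\<close>

lemma cluster_form_pos: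
  assumes "J \<in> clusters" "t \<in> S"
  shows "cluster_form t J > 0"
proof -
  obtain i where i: "i \<in> J" using cluster_nonempty[OF assms(1)] by blast
  have "fiber_sum J e (c t) (c t i) \<noteq> 0"
  proof (rule fiber_sum_nonzero)
    have lt: "j < n" if "j \<in> J" for j using cluster_subset[OF assms(1)] that by auto
    show "e i \<noteq> 0" using sign[OF lt[OF i]] by auto
    show "e j = e i" if "j \<in> J" "c t j = c t i" for j
      by (rule same_sign[OF assms(2) lt[OF that(1)] lt[OF i] that(2)])
  qed (use i finite_clusters(2)[OF assms(1)] in auto)
  then have "cluster_form t J \<noteq> 0"
    using qform_definite[OF cluster_props(1,2)[OF assms], of "fiber_sum J e (c t)" "c t i"] i
    by (meson imageI of_int_eq_0_iff)
  moreover have "cluster_form t J \<ge> 0"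
    using cluster_props(1,2)[OF assms] by (intro qform_nonneg) auto
  ultimately show ?thesis by simp
qed

lemma cluster_form_ge_1:
  assumes "J \<in> clusters" "t \<in> S" "cslope t J \<noteq> 0"
  shows "cluster_form t J \<ge> 1"
    "cluster_form t J = 1 \<Longrightarrow> atom (fiber_sum J e (c t))"
proof -
  note props = cluster_props[OF assms(1,2)]
  have "(\<Sum>v\<in>c t ` J. fiber_sum J e (c t) v * int v) \<noteq> 0" unfolding props(3) by (rule assms(3))
  note * = qform_ge_1[OF props(1,2) this props(5)]
  show "cluster_form t J \<ge> 1" by (rule *(1))
  show "cluster_form t J = 1 \<Longrightarrow> atom (fiber_sum J e (c t))" unfolding atom_def by (rule *(2))
qed

lemma cluster_form_ge_3:
  assumes "J \<in> clusters" "t \<in> S" "cslope t J = 0" "odd (\<Sum>i\<in>J. e i)"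
  shows "cluster_form t J \<ge> 3"
  using cluster_props[OF assms(1,2)] assms(3,4) by (intro qform_ge_3) auto

text \<open>The forms of all clusters are positive and add up to 3, so a subfamily that already
  reaches 3 leaves no room for another cluster.\<close>

lemma clusters_subset_if:
  assumes "t \<in> S" "P \<subseteq> clusters" "(\<Sum>J\<in>P. cluster_form t J) \<ge> 3"
  shows "clusters = P" "(\<Sum>J\<in>P. cluster_form t J) = 3"
proof -
  have finP: "finite P" using assms(2) finite_clusters(1) by (rule finite_subset)
  have split: "(\<Sum>J\<in>clusters - P. cluster_form t J) + (\<Sum>J\<in>P. cluster_form t J) = 3"
    using sum.subset_diff[OF assms(2) finite_clusters(1)] sum_cluster_forms[OF assms(1)] by metis
  have "clusters - P = {}"
  proof (rule ccontr)
    assume "clusters - P \<noteq> {}"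
    then have "(\<Sum>J\<in>clusters - P. cluster_form t J) > 0"
      using cluster_form_pos assms(1) finite_clusters(1) by (intro sum_pos) auto
    then show False using split assms(3) by simp
  qed
  then show "clusters = P" using assms(2) by auto
  then show "(\<Sum>J\<in>P. cluster_form t J) = 3" using sum_cluster_forms[OF assms(1)] by simp
qed

lemma single_cluster_rel:
  assumes "clusters = {J}" "i < n" "j < n"
  shows "rel i j"
proof -
  have "cluster i \<in> {J}" "cluster j \<in> {J}"
    unfolding assms(1)[symmetric] clusters_def using assms(2,3) by auto
  then have "cluster i = cluster j" by simp
  then show ?thesis using rel_refl assms(3) by (auto simp: cluster_def)
qed

text \<open>Each cluster of nonzero slope contributes at least 1 to the total 3, so there are at
  most three of them. Fewer than three are ruled out one by one; with three, each form equals 1,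
  each cluster is an atom, and there is no further cluster.\<close>

lemma three_atoms:
  assumes t: "t \<in> S" and not_all: "\<exists>i<n. \<exists>j<n. \<not> rel i j"
  shows "\<exists>m1 m2 m3. atom m1 \<and> atom m2 \<and> atom m3 \<and>
    (\<forall>v. fiber_sum {..<n} e (c t) v = m1 v + m2 v + m3 v) \<and>
    (\<forall>v. (0 \<le> m1 v \<and> 0 \<le> m2 v \<and> 0 \<le> m3 v) \<or> (m1 v \<le> 0 \<and> m2 v \<le> 0 \<and> m3 v \<le> 0))"
proof -
  define P where "P = {J\<in>clusters. cslope t J \<noteq> 0}"
  have P: "P \<subseteq> clusters" "finite P" using finite_clusters(1) by (auto simp: P_def)
  \<comment> \<open>Whether a slope vanishes does not depend on the tuple, so the set
    \<open>P\<close> chosen at \<open>t\<close> serves every \<open>u\<close>.\<close>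
  have slopeP: "(\<Sum>J\<in>P. cslope u J) = 0" if "u \<in> S" for u
  proof -
    have "(\<Sum>J\<in>clusters. cslope u J) = 0"
      using slope[OF that] unfolding cslope_def sum_clusters .
    moreover have "(\<Sum>J\<in>P. cslope u J) = (\<Sum>J\<in>clusters. cslope u J)"
      using finite_clusters(1) cslope_zero_iff[OF _ that t] unfolding P_def
      by (intro sum.mono_neutral_left) auto
    ultimately show ?thesis by simp
  qed
  have ge1: "cluster_form t J \<ge> 1" if "J \<in> P" for J
    using that t cluster_form_ge_1(1) by (auto simp: P_def)
  have "real (card P) = (\<Sum>J\<in>P. 1)" by simp
  also have "\<dots> \<le> (\<Sum>J\<in>P. cluster_form t J)" using ge1 by (intro sum_mono) auto
  also have "\<dots> \<le> (\<Sum>J\<in>clusters. cluster_form t J)"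
    using P finite_clusters(1) cluster_form_pos[OF _ t] by (intro sum_mono2) (auto intro: less_imp_le)
  also have "\<dots> = 3" using sum_cluster_forms[OF t] .
  finally have "card P \<le> 3" by simp
  \<comment> \<open>All slopes would vanish. The signs are odd and \<open>n\<close> is odd, so some
    cluster has an odd sum of signs and thus form at least 3. It would be the only cluster, against
    \<open>not_all\<close>.\<close>
  moreover have "card P \<noteq> 0"
  proof
    assume "card P = 0"
    then have zero: "cslope t J = 0" if "J \<in> clusters" for J using that P by (auto simp: P_def)
    have "{i. i < n \<and> odd (e i)} = {..<n}" using sign by force
    then have "odd (\<Sum>i<n. e i)" using odd by (simp add: even_sum_iff)
    then obtain J where J: "J \<in> clusters" "odd (\<Sum>i\<in>J. e i)"
      unfolding sum_clusters using dvd_sum[of clusters 2 "\<lambda>J. \<Sum>i\<in>J. e i"] by blast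
    have "clusters = {J}"
      using J t cluster_form_ge_3 zero by (intro clusters_subset_if) auto
    then show False using single_cluster_rel not_all by blast
  qed
  moreover have "card P \<noteq> 1"
  proof
    assume "card P = 1"
    then obtain J where J: "P = {J}" by (auto simp: card_1_singleton_iff)
    then have "cslope t J \<noteq> 0" by (auto simp: P_def)
    then show False using slopeP[OF t] J by simp
  qed
  \<comment> \<open>The two slopes would be opposite for every tuple, so both clusters would scale
    by the same factor between tuples and would have to coincide.\<close>
  moreover have "card P \<noteq> 2"
  proof
    assume "card P = 2"
    then obtain J1 J2 where J: "P = {J1, J2}" "J1 \<noteq> J2" by (auto simp: card_2_iff)
    then have Jc: "J1 \<in> clusters" "J2 \<in> clusters" "cslope t J1 \<noteq> 0" by (auto simp: P_def)
    obtain i j where ij: "i \<in> J1" "j \<in> J2" using cluster_nonempty Jc by blast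
    have cross: "c u i * c t j = c t i * c u j" if "u \<in> S" for u
    proof -
      have neg: "cslope w J2 = - cslope w J1" if "w \<in> S" for w
        using slopeP[OF that] J by simp
      note p1 = cslope_proportional[OF Jc(1) ij(1) that t]
      have p2: "cslope u J1 * int (c t j) = cslope t J1 * int (c u j)"
        using cslope_proportional[OF Jc(2) ij(2) that t] neg[OF that] neg[OF t] by simp
      have "cslope t J1 * (int (c u i) * int (c t j)) = (cslope u J1 * int (c t i)) * int (c t j)"
        using p1 by simp
      also have "\<dots> = (cslope u J1 * int (c t j)) * int (c t i)" by simp
      also have "\<dots> = cslope t J1 * (int (c t i) * int (c u j))" using p2 by simp
      finally have "int (c u i * c t j) = int (c t i * c u j)" using Jc(3) by simp
      then show ?thesis by (simp only: of_nat_eq_iff)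
    qed
    have n: "i < n" "j < n" using ij Jc cluster_subset by auto
    have "rel i j"
      unfolding rel_def
    proof (intro ballI)
      fix u w assume uw: "u \<in> S" "w \<in> S"
      have "(c u i * c w j) * (c t i * c t j) = (c u i * c t j) * (c t i * c w j)" by simp
      also have "\<dots> = (c t i * c u j) * (c w i * c t j)" using cross[OF uw(1)] cross[OF uw(2)] by simp
      also have "\<dots> = (c w i * c u j) * (c t i * c t j)" by simp
      finally show "c u i * c w j = c w i * c u j" using pos[OF t n(1)] pos[OF t n(2)] by simp
    qed
    then have "cluster i = cluster j"
      using rel_sym rel_trans n unfolding cluster_def by blast
    then show False using cluster_eq ij Jc J(2) by metis
  qed
  ultimately have "card P = 3" by linarith
  then obtain J1 J2 J3 where J: "P = {J1, J2, J3}" "J1 \<noteq> J2" "J2 \<noteq> J3" "J1 \<noteq> J3"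
    by (auto simp: card_3_iff)
  have sum3: "(\<Sum>J\<in>P. h J) = h J1 + (h J2 + h J3)" for h :: "nat set \<Rightarrow> 'x::comm_monoid_add"
    using J by simp
  have "(\<Sum>J\<in>P. cluster_form t J) \<ge> 3" using ge1[of J1] ge1[of J2] ge1[of J3] J sum3[of "cluster_form t"] by auto
  note all = clusters_subset_if[OF t P(1) this]
  have one: "cluster_form t J1 = 1" "cluster_form t J2 = 1" "cluster_form t J3 = 1"
    using all(2) ge1[of J1] ge1[of J2] ge1[of J3] J(1) unfolding sum3 by auto
  have atoms: "atom (fiber_sum J e (c t))" if "J \<in> P" for J
    using that one J(1) t by (intro cluster_form_ge_1(2)) (auto simp: P_def)
  have total: "fiber_sum {..<n} e (c t) v =
      fiber_sum J1 e (c t) v + fiber_sum J2 e (c t) v + fiber_sum J3 e (c t) v" for v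
  proof -
    have "fiber_sum {..<n} e (c t) v = (\<Sum>J\<in>P. fiber_sum J e (c t) v)"
      unfolding fiber_sum_def sum_clusters using all(1) by simp
    then show ?thesis by (simp add: sum3 add.assoc)
  qed
  \<comment> \<open>Equal entries carry equal signs even across clusters, so the three atoms never
    cancel at a value.\<close>
  have signs: "(\<forall>J\<in>P. 0 \<le> fiber_sum J e (c t) v) \<or> (\<forall>J\<in>P. fiber_sum J e (c t) v \<le> 0)" for v
  proof (cases "\<exists>i<n. c t i = v \<and> e i = 1")
    case True
    then obtain i where i: "i < n" "c t i = v" "e i = 1" by blast
    have "0 \<le> fiber_sum J e (c t) v" if "J \<in> P" for J
      unfolding fiber_sum_def
    proof (rule sum_nonneg)
      fix j assume "j \<in> J"
      then have "j < n" using that P cluster_subset by auto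
      then show "0 \<le> e j * spike (c t j) v"
        using same_sign[OF t i(1)] i by (auto simp: spike_def)
    qed
    then show ?thesis by blast
  next
    case False
    have "fiber_sum J e (c t) v \<le> 0" if "J \<in> P" for J
      unfolding fiber_sum_def
    proof (rule sum_nonpos)
      fix j assume "j \<in> J"
      then have "j < n" using that P cluster_subset by auto
      then show "e j * spike (c t j) v \<le> 0" using sign[of j] False by (auto simp: spike_def)
    qed
    then show ?thesis by blast
  qed
  have mem: "J1 \<in> P" "J2 \<in> P" "J3 \<in> P" using J(1) by auto
  show ?thesis
  proof (intro exI conjI allI)
    show "atom (fiber_sum J1 e (c t))" "atom (fiber_sum J2 e (c t))" "atom (fiber_sum J3 e (c t))"
      using atoms mem by blast+
    show "fiber_sum {..<n} e (c t) v =
      fiber_sum J1 e (c t) v + fiber_sum J2 e (c t) v + fiber_sum J3 e (c t) v" for v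
      by (rule total)
    show "(0 \<le> fiber_sum J1 e (c t) v \<and> 0 \<le> fiber_sum J2 e (c t) v \<and> 0 \<le> fiber_sum J3 e (c t) v) \<or>
      (fiber_sum J1 e (c t) v \<le> 0 \<and> fiber_sum J2 e (c t) v \<le> 0 \<and> fiber_sum J3 e (c t) v \<le> 0)" for v
      using signs[of v] mem by blast
  qed
qed

end

section \<open>Classification\<close>

text \<open>\<open>A\<close> and \<open>B\<close> are the entries that one cluster contributes above and below the fraction bar.\<close>

definition block :: "nat \<Rightarrow> nat multiset \<Rightarrow> nat multiset \<Rightarrow> bool" where
  "block d A B \<longleftrightarrow> A = {#d#} \<and> B = {#} \<or> A = {#} \<and> B = {#d#} \<or>
     A = {#2 * d#} \<and> B = {#d#} \<or> A = {#d#} \<and> B = {#2 * d#}"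

text \<open>\<open>A\<close> and \<open>B\<close> are the positive and the negative part of
  \<open>m\<close>; the four forms of a block come from two kinds of atoms and two signs.\<close>

lemma atom_block:
  assumes "atom m"
  shows "\<exists>d A B. d > 0 \<and> block d A B \<and>
    (\<forall>v. int (count A v) = max 0 (m v)) \<and> (\<forall>v. int (count B v) = max 0 (- m v))"
proof -
  obtain d s where d: "d > 0" and s: "s = 1 \<or> s = -1" and
    m: "(\<forall>v. m v = s * spike d v) \<or> (\<forall>v. m v = s * (spike (2 * d) v - spike d v))"
    using assms unfolding atom_def by auto
  from s m consider "\<forall>v. m v = spike d v" | "\<forall>v. m v = - spike d v"
    | "\<forall>v. m v = spike (2 * d) v - spike d v" | "\<forall>v. m v = spike d v - spike (2 * d) v"
    by auto
  then show ?thesis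
  proof cases
    case 1
    then show ?thesis using d
      by (intro exI[of _ d] exI[of _ "{#d#}"] exI[of _ "{#}"]) (auto simp: block_def spike_def)
  next
    case 2
    then show ?thesis using d
      by (intro exI[of _ d] exI[of _ "{#}"] exI[of _ "{#d#}"]) (auto simp: block_def spike_def)
  next
    case 3
    then show ?thesis using d
      by (intro exI[of _ d] exI[of _ "{#2 * d#}"] exI[of _ "{#d#}"]) (auto simp: block_def spike_def)
  next
    case 4
    then show ?thesis using d
      by (intro exI[of _ d] exI[of _ "{#d#}"] exI[of _ "{#2 * d#}"]) (auto simp: block_def spike_def)
  qed
qed

text \<open>A common divisor of \<open>a\<close> and \<open>b\<close> divides every entry of the
  tuple, so coprimality follows from the gcd condition.\<close>

lemma in_familyI:
  assumes "Gcd (set as \<union> set bs) = 1" "a > 0" "b > 0"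
    and "mset as = {#a + b#} \<and> mset bs = {#a, b#} \<or>
         mset as = {#2 * a, 2 * b#} \<and> mset bs = {#a, b, a + b#} \<or>
         a > b \<and> mset as = {#2 * a, b#} \<and> mset bs = {#a, 2 * b, a - b#}"
  shows "in_family as bs"
proof -
  have "coprime a b"
  proof (rule coprimeI)
    fix x assume x: "x dvd a" "x dvd b"
    have "set as = set_mset (mset as)" "set bs = set_mset (mset bs)" by simp_all
    then have "x dvd y" if "y \<in> set as \<union> set bs" for y
      using assms(4) x that by (elim disjE conjE) (auto simp del: set_mset_mset intro: dvd_diff_nat)
    then have "x dvd Gcd (set as \<union> set bs)" by (rule Gcd_greatest)
    then show "is_unit x" using assms(1) by simp
  qed
  then show ?thesis unfolding in_family_def using assms by blast
qed

text \<open>The denominator has one entry more than the numerator. So either two blocks are single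
  denominator entries and one is a single numerator entry, or one block is a single denominator
  entry and the others are pairs. Equality of the sums then gives the linear relation among the
  \<open>d\<close> values that each family requires.\<close>

lemma three_blocks_in_family:
  assumes "mset as = A1 + A2 + A3" "mset bs = B1 + B2 + B3"
    and blocks: "block d1 A1 B1" "block d2 A2 B2" "block d3 A3 B3"
    and pos: "d1 > 0" "d2 > 0" "d3 > 0"
    and adm: "admissible as bs"
  shows "in_family as bs"
proof -
  have gcd: "Gcd (set as \<union> set bs) = 1" using adm by (simp add: admissible_def)
  have "size (mset bs) = size (mset as) + 1" using adm by (simp add: admissible_def)
  then have size: "size B1 + size B2 + size B3 = size A1 + size A2 + size A3 + 1"
    unfolding assms(1,2) by simp
  have "sum_mset (mset bs) = sum_mset (mset as)"
    using adm by (simp add: admissible_def sum_mset_sum_list)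
  then have sum: "sum_mset B1 + sum_mset B2 + sum_mset B3 = sum_mset A1 + sum_mset A2 + sum_mset A3"
    unfolding assms(1,2) by simp
  define X Y where "X = mset as" "Y = mset bs"
  have fam1: "in_family as bs" if "X = {#c#}" "Y = {#a, b#}" "c = a + b" "a > 0" "b > 0" for a b c
    using in_familyI[OF gcd that(4,5)] that by (simp add: X_Y_def)
  have fam2: "in_family as bs"
    if "X = {#2 * a, 2 * b#}" "Y = {#a, b, c#}" "c = a + b" "a > 0" "b > 0" for a b c
    using in_familyI[OF gcd that(4,5)] that by (simp add: X_Y_def)
  have fam3: "in_family as bs"
    if "X = {#2 * a, b#}" "Y = {#a, 2 * b, c#}" "a = b + c" "b > 0" "c > 0" for a b c
    using in_familyI[OF gcd, of a b] that by (simp add: X_Y_def)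
  have "X = A1 + A2 + A3" "Y = B1 + B2 + B3" using assms(1,2) by (simp_all add: X_Y_def)
  then show ?thesis
    using blocks size sum pos unfolding block_def
    \<comment> \<open>Of the 64 combinations, 15 have the right sizes. The 3 with two pairs of the
      form {d; 2d} contradict the equality of the sums; the remaining 12 split as 3, 3 and 6 over
      the three families.\<close>
    apply (elim disjE conjE)
    apply simp_all
    subgoal by (rule fam1[of d1 d3 d2]) auto
    subgoal by (rule fam1[of d2 d3 d1]) auto
    subgoal by (rule fam1[of d3 d2 d1]) auto
    subgoal by (rule fam2[of d3 d2 d1]) auto
    subgoal by (rule fam3[of d2 d3 d1]) auto
    subgoal by (rule fam3[of d3 d2 d1]) auto
    subgoal by (rule fam2[of d3 d1 d2]) auto
    subgoal by (rule fam3[of d1 d3 d2]) auto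
    subgoal by (rule fam3[of d3 d1 d2]) auto
    subgoal by (rule fam2[of d2 d1 d3]) auto
    subgoal by (rule fam3[of d1 d2 d3]) auto
    subgoal by (rule fam3[of d2 d1 d3]) auto
    done
qed

section \<open>Passage between lists and signed indices, and the final assembly\<close>

lemma sum_append_signs:
  fixes h :: "nat \<Rightarrow> 'a::comm_ring_1"
  shows "(\<Sum>i<length as + length bs. of_int (if i < length as then 1 else -1) * h ((as @ bs) ! i)) =
    (\<Sum>a\<leftarrow>as. h a) - (\<Sum>b\<leftarrow>bs. h b)"
proof (induction bs rule: rev_induct)
  case Nil
  have "(\<Sum>i<length as. of_int (if i < length as then 1 else -1) * h (as ! i)) = (\<Sum>i<length as. h (as ! i))"
    by (intro sum.cong) auto
  then show ?case by (simp add: sum_list_sum_nth atLeast0LessThan)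
next
  case (snoc b bs)
  have "(\<Sum>i<length as + length bs. of_int (if i < length as then 1 else -1) * h ((as @ bs @ [b]) ! i)) =
    (\<Sum>i<length as + length bs. of_int (if i < length as then 1 else -1) * h ((as @ bs) ! i))"
    by (intro sum.cong refl) (auto simp: nth_append)
  then show ?case using snoc by (simp add: nth_append)
qed

lemma fiber_sum_mass:
  "fiber_sum {..<length as + length bs} (\<lambda>i. if i < length as then 1 else -1) (\<lambda>i. (as @ bs) ! i) v =
    mass as bs v"
proof -
  have "(\<Sum>a\<leftarrow>xs. spike a v) = int (count (mset xs) v)" for xs
    by (induction xs) (auto simp: spike_def)
  then show ?thesis
    using sum_append_signs[where h = "\<lambda>x. spike x v" and as = as and bs = bs]
    by (simp add: fiber_sum_def mass_def)
qed

text \<open>Multiplying \<open>y\<close> by \<open>x ! i\<close> and \<open>x\<close> by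
  \<open>y ! i\<close> gives the same entries; comparing the gcds yields
  \<open>x ! i = y ! i\<close>.\<close>

lemma eq_of_proportional:
  fixes x y :: "nat list"
  assumes "length x = length y" "\<And>i j. i < length x \<Longrightarrow> j < length x \<Longrightarrow> x ! i * y ! j = y ! i * x ! j"
    "Gcd (set x) = 1" "Gcd (set y) = 1"
  shows "x = y"
proof (rule nth_equalityI)
  fix i assume i: "i < length x"
  have "(*) (x ! i) ` set y = (*) (y ! i) ` set x"
    using assms(1,2) i by (force simp: set_conv_nth image_def)
  then have "Gcd ((*) (x ! i) ` set y) = Gcd ((*) (y ! i) ` set x)" by simp
  then show "x ! i = y ! i" using assms(3,4) by (simp add: Gcd_mult)
qed (rule assms(1))

text \<open>The three summands have a common sign at each value, so positive and negative parts are
  additive.\<close>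

lemma mset_of_signed_parts:
  assumes "set as \<inter> set bs = {}"
    and "\<And>v. mass as bs v = m1 v + m2 v + m3 v"
    and "\<And>v. (0 \<le> m1 v \<and> 0 \<le> m2 v \<and> 0 \<le> m3 v) \<or> (m1 v \<le> 0 \<and> m2 v \<le> 0 \<and> m3 v \<le> 0)"
    and "\<And>v. int (count A1 v) = max 0 (m1 v)" "\<And>v. int (count A2 v) = max 0 (m2 v)"
      "\<And>v. int (count A3 v) = max 0 (m3 v)"
    and "\<And>v. int (count B1 v) = max 0 (- m1 v)" "\<And>v. int (count B2 v) = max 0 (- m2 v)"
      "\<And>v. int (count B3 v) = max 0 (- m3 v)"
  shows "mset as = A1 + A2 + A3" "mset bs = B1 + B2 + B3"
proof -
  have *: "count (mset as) v = 0 \<or> count (mset bs) v = 0" for v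
    using assms(1) by (auto simp: count_mset_0_iff)
  have "int (count (mset as) v) = max 0 (mass as bs v) \<and> int (count (mset bs) v) = max 0 (- mass as bs v)" for v
    using *[of v] unfolding mass_def by linarith
  then have "int (count (mset as) v) = int (count (A1 + A2 + A3) v) \<and>
      int (count (mset bs) v) = int (count (B1 + B2 + B3) v)" for v
    using assms(2,3)[of v] assms(4-9)[of v] unfolding count_union of_nat_add by smt
  then have "count (mset as) v = count (A1 + A2 + A3) v \<and> count (mset bs) v = count (B1 + B2 + B3) v" for v
    by (simp only: of_nat_eq_iff)
  then show "mset as = A1 + A2 + A3" "mset bs = B1 + B2 + B3"
    by (metis multiset_eqI)+
qed

text \<open>An infinite set of exceptions of one length would contain an infinite
  \<open>ratio_family\<close>; by \<open>three_atoms\<close> its members decompose into three blocks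
  and so belong to a family after all.\<close>

lemma finite_exceptional_of_length:
  assumes exc: "\<And>as bs. (as, bs) \<in> S \<Longrightarrow> admissible as bs \<and> length as = k \<and> \<not> in_family as bs"
  shows "finite S"
proof (rule ccontr)
  assume infS: "infinite S"
  define n where "n = 2 * k + 1"
  define c where "c = (\<lambda>t::nat list \<times> nat list. \<lambda>i. (fst t @ snd t) ! i)"
  define e where "e = (\<lambda>i. if i < k then 1 else -1 :: int)"
  define H where "H = (\<lambda>(i, j) t. real (c t i) / real (c t j)) ` ({..<n} \<times> {..<n})"
  have "finite H" by (simp add: H_def)
  from infinite_subset_const_or_inj[OF this infS] obtain T where T: "T \<subseteq> S" "infinite T" "\<forall>h\<in>H. (\<exists>v. \<forall>t\<in>T. h t = v) \<or> inj_on h T"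
    by auto
  have adm: "admissible as bs" and nf: "\<not> in_family as bs" and len1: "length as = k"
    if "(as, bs) \<in> T" for as bs
    using exc[OF subsetD[OF T(1) that]] by blast+
  have len: "length as = k" "length bs = k + 1" "length as + length bs = n"
    if "(as, bs) \<in> T" for as bs
    using len1[OF that] adm[OF that] unfolding admissible_def n_def by linarith+
  have cset: "c (as, bs) i \<in> set as \<union> set bs" if "(as, bs) \<in> T" "i < n" for as bs i
    using that len[OF that(1)] nth_mem[of i "as @ bs"] by (auto simp: c_def)
  have e_sum: "(\<Sum>i<n. of_int (e i) * h (c (as, bs) i)) = (\<Sum>a\<leftarrow>as. h a) - (\<Sum>b\<leftarrow>bs. h b)"
    if "(as, bs) \<in> T" for as bs and h :: "nat \<Rightarrow> 'a::comm_ring_1"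
    using sum_append_signs[where as = as and bs = bs and h = h]
    unfolding len(3)[OF that] unfolding len(1)[OF that] by (simp add: c_def e_def)
  have mass: "fiber_sum {..<n} e (c (as, bs)) v = mass as bs v" if "(as, bs) \<in> T" for as bs v
    using fiber_sum_mass[of as bs v]
    unfolding len(3)[OF that] unfolding len(1)[OF that] by (simp add: c_def e_def)
  have in_as: "c (as, bs) i \<in> set as \<longleftrightarrow> i < k" if "(as, bs) \<in> T" "i < n" for as bs i
  proof -
    have "i < k \<Longrightarrow> c (as, bs) i \<in> set as" using len[OF that(1)] by (simp add: c_def nth_append)
    moreover have "\<not> i < k \<Longrightarrow> c (as, bs) i \<in> set bs"
      using len[OF that(1)] that(2) by (simp add: c_def nth_append n_def)
    ultimately show ?thesis using adm[OF that(1)] by (auto simp: admissible_def)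
  qed
  interpret ratio_family T n c e
  proof
    show "infinite T" by fact
    show "odd n" by (simp add: n_def)
    show "e i \<in> {1, -1}" for i by (simp add: e_def)
    show "c t i > 0" if "t \<in> T" "i < n" for t i
      using cset adm that by (cases t) (fastforce simp: admissible_def)
    \<comment> \<open>Numerator and denominator entries never coincide, so the value of an entry
      reveals its side.\<close>
    show "e i = e j" if "t \<in> T" "i < n" "j < n" "c t i = c t j" for t i j
      using in_as[of "fst t" "snd t" i] in_as[of "fst t" "snd t" j] that by (simp add: e_def)
    show "(\<Sum>i<n. e i * int (c t i)) = 0" if "t \<in> T" for t
    proof -
      have "(\<Sum>a\<leftarrow>xs. int a) = int (sum_list xs)" for xs by (induction xs) auto
      then show ?thesis
        using e_sum[of "fst t" "snd t" int] adm[of "fst t" "snd t"] that by (simp add: admissible_def)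
    qed
    show "(\<Sum>i<n. \<Sum>j<n. of_int (e i) * of_int (e j) / real (ht (c t i) (c t j))) = 3" if t: "t \<in> T" for t
    proof (cases t)
      case (Pair as bs)
      have "qform {} (set as \<union> set bs) (fiber_sum {..<n} e (c (as, bs))) = 3"
        using admissible_qform[OF adm[of as bs]] t mass[of as bs] Pair by simp
      moreover have "c (as, bs) ` {..<n} \<subseteq> set as \<union> set bs" using cset t Pair by auto
      ultimately show ?thesis using qform_fiber_sum[of "set as \<union> set bs" "c (as, bs)" "{..<n}" e] Pair by simp
    qed
    show "(\<exists>q. \<forall>t\<in>T. real (c t i) / real (c t j) = q) \<or> inj_on (\<lambda>t. real (c t i) / real (c t j)) T"
      if "i < n" "j < n" for i j
    proof -
      have "(\<lambda>t. real (c t i) / real (c t j)) \<in> H"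
        unfolding H_def using that by (intro image_eqI[of _ _ "(i, j)"]) auto
      then show ?thesis using T(3) by fast
    qed
  qed
  \<comment> \<open>Otherwise all tuples in \<open>T\<close> would be proportional, hence equal
    because their gcds are 1, and \<open>T\<close> would be finite.\<close>
  have "\<exists>i<n. \<exists>j<n. \<not> rel i j"
  proof (rule ccontr)
    assume all: "\<not> ?thesis"
    have "t = u" if tu: "t \<in> T" "u \<in> T" for t u
    proof -
      obtain as bs as' bs' where p: "t = (as, bs)" "u = (as', bs')" by (cases t, cases u) auto
      note l = len[OF tu(1)[unfolded p]] len[OF tu(2)[unfolded p]]
      have "as @ bs = as' @ bs'"
      proof (rule eq_of_proportional)
        fix i j assume "i < length (as @ bs)" "j < length (as @ bs)"
        then have "rel i j" using all l by auto
        then have "c t i * c u j = c u i * c t j" using tu unfolding rel_def by blast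
        then show "(as @ bs) ! i * (as' @ bs') ! j = (as' @ bs') ! i * (as @ bs) ! j"
          by (simp add: p c_def)
      qed (use l adm[OF tu(1)[unfolded p]] adm[OF tu(2)[unfolded p]] in \<open>auto simp: admissible_def\<close>)
      then show ?thesis using l p by simp
    qed
    then have "T \<subseteq> {t}" if "t \<in> T" for t using that by blast
    then show False using T(2) by (metis finite.emptyI finite_insert finite_subset all_not_in_conv)
  qed
  moreover obtain as bs where t: "(as, bs) \<in> T" using T(2) by (metis all_not_in_conv finite.emptyI surj_pair)
  ultimately obtain m1 m2 m3 where m: "atom m1" "atom m2" "atom m3"
    "\<And>v. mass as bs v = m1 v + m2 v + m3 v"
    "\<And>v. (0 \<le> m1 v \<and> 0 \<le> m2 v \<and> 0 \<le> m3 v) \<or> (m1 v \<le> 0 \<and> m2 v \<le> 0 \<and> m3 v \<le> 0)"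
    using three_atoms[OF t] mass[OF t] by auto
  obtain d1 A1 B1 where b1: "d1 > 0" "block d1 A1 B1" "\<And>v. int (count A1 v) = max 0 (m1 v)"
    "\<And>v. int (count B1 v) = max 0 (- m1 v)" using atom_block[OF m(1)] by blast
  obtain d2 A2 B2 where b2: "d2 > 0" "block d2 A2 B2" "\<And>v. int (count A2 v) = max 0 (m2 v)"
    "\<And>v. int (count B2 v) = max 0 (- m2 v)" using atom_block[OF m(2)] by blast
  obtain d3 A3 B3 where b3: "d3 > 0" "block d3 A3 B3" "\<And>v. int (count A3 v) = max 0 (m3 v)"
    "\<And>v. int (count B3 v) = max 0 (- m3 v)" using atom_block[OF m(3)] by blast
  have "set as \<inter> set bs = {}" using adm[OF t] by (auto simp: admissible_def)
  note parts = mset_of_signed_parts[OF this m(4,5) b1(3) b2(3) b3(3) b1(4) b2(4) b3(4)]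
  have "in_family as bs"
    using three_blocks_in_family[OF parts b1(2) b2(2) b3(2) b1(1) b2(1) b3(1) adm[OF t]] .
  then show False using nf[OF t] by simp
qed

theorem theorem5p1:
  shows "finite {(as, bs). admissible as bs \<and> \<not> in_family as bs}"
proof -
  have "{(as, bs). admissible as bs \<and> \<not> in_family as bs} \<subseteq>
      (\<Union>k\<le>1000000. {(as, bs). admissible as bs \<and> length as = k \<and> \<not> in_family as bs})"
    using admissible_length_bound by auto
  moreover have "finite (\<Union>k\<le>1000000::nat. {(as, bs). admissible as bs \<and> length as = k \<and> \<not> in_family as bs})"
    by (intro finite_UN_I finite_exceptional_of_length) auto
  ultimately show ?thesis by (rule finite_subset)
qed

end
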